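(* Let $R$ be a Noetherian ring, let $I,J$ be ideals of $R$, let $T$ be a finitely generated $R$-module and let $U,V,W$ be submodules of $T$ with $W\subseteq V$. For $n\ge 0$ put $T_n=(U+I^nV)/I^nW$. Then the sequence $\{\operatorname{depth}_J T_n\}_{n\ge 0}$ is eventually constant.
   Context: For a finitely generated module $N$, $\operatorname{depth}_J N$ is the length of a maximal $N$-regular sequence in $J$, with the convention $\operatorname{depth}_J N=\infty$ if $JN=N$. *)

theory Defs
  imports Main "HOL-Library.Extended_Nat"
begin

definition ideal :: "'a::comm_ring_1 set \<Rightarrow> bool" where
  "ideal I \<longleftrightarrow> module.subspace ((*) :: 'a \<Rightarrow> 'a \<Rightarrow> 'a) I"

definition noetherian_ring :: "'a::comm_ring_1 itself \<Rightarrow> bool" where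
  "noetherian_ring _ \<longleftrightarrow>
     (\<forall>I::'a set. ideal I \<longrightarrow> (\<exists>F. finite F \<and> I = module.span ((*) :: 'a \<Rightarrow> 'a \<Rightarrow> 'a) F))"

fun ideal_pow :: "'a::comm_ring_1 set \<Rightarrow> nat \<Rightarrow> 'a set" where
  "ideal_pow I 0 = UNIV"
| "ideal_pow I (Suc n) =
     module.span ((*) :: 'a \<Rightarrow> 'a \<Rightarrow> 'a) {a * b | a b. a \<in> ideal_pow I n \<and> b \<in> I}"

definition smod :: "('a::comm_ring_1 \<Rightarrow> 'b::ab_group_add \<Rightarrow> 'b) \<Rightarrow> 'a set \<Rightarrow> 'b set \<Rightarrow> 'b set" where
  "smod scale I N = module.span scale {scale a x | a x. a \<in> I \<and> x \<in> N}"

definition msum :: "('a::comm_ring_1 \<Rightarrow> 'b::ab_group_add \<Rightarrow> 'b) \<Rightarrow> 'b set \<Rightarrow> 'b set \<Rightarrow> 'b set" where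
  "msum scale A B = module.span scale (A \<union> B)"

definition fin_gen :: "('a::comm_ring_1 \<Rightarrow> 'b::ab_group_add \<Rightarrow> 'b) \<Rightarrow> 'b set \<Rightarrow> bool" where
  "fin_gen scale T \<longleftrightarrow> (\<exists>F. finite F \<and> T = module.span scale F)"

text \<open>Quotient modules N/L (L a submodule of N) are represented by the pair (N, L).
  The sequence xs = [x_1,...,x_r] is (N/L)-regular in J iff every x_i lies in J,
  x_(i+1) is a nonzerodivisor on N/(L + (x_1,...,x_i)N), and N /= L + (x_1,...,x_r)N.\<close>
definition regular_seq ::
  "('a::comm_ring_1 \<Rightarrow> 'b::ab_group_add \<Rightarrow> 'b) \<Rightarrow> 'a set \<Rightarrow> 'b set \<Rightarrow> 'b set \<Rightarrow> 'a list \<Rightarrow> bool" where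
  "regular_seq scale J N L xs \<longleftrightarrow>
     set xs \<subseteq> J \<and>
     (\<forall>i < length xs. \<forall>y \<in> N.
        scale (xs ! i) y \<in> msum scale L (smod scale (set (take i xs)) N) \<longrightarrow>
        y \<in> msum scale L (smod scale (set (take i xs)) N)) \<and>
     \<not> N \<subseteq> msum scale L (smod scale (set xs) N)"

definition maximal_regular_seq ::
  "('a::comm_ring_1 \<Rightarrow> 'b::ab_group_add \<Rightarrow> 'b) \<Rightarrow> 'a set \<Rightarrow> 'b set \<Rightarrow> 'b set \<Rightarrow> 'a list \<Rightarrow> bool" where
  "maximal_regular_seq scale J N L xs \<longleftrightarrow>
     regular_seq scale J N L xs \<and> \<not> (\<exists>y \<in> J. regular_seq scale J N L (xs @ [y]))"

text \<open>depth_J (N/L): infinity if J(N/L) = N/L, otherwise the length of a maximal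
  (N/L)-regular sequence in J (all such have the same length for finitely generated
  modules over Noetherian rings; we take the supremum of these lengths).\<close>
definition depth ::
  "('a::comm_ring_1 \<Rightarrow> 'b::ab_group_add \<Rightarrow> 'b) \<Rightarrow> 'a set \<Rightarrow> 'b set \<Rightarrow> 'b set \<Rightarrow> enat" where
  "depth scale J N L =
     (if N \<subseteq> msum scale L (smod scale J N) then \<infinity>
      else Sup {enat (length xs) | xs. maximal_regular_seq scale J N L xs})"

end

theory Submission
  imports Defs "HOL-Library.Function_Algebras"
begin

text \<open>The depth of \<open>N/L\<close> in \<open>J\<close> is the first degree in which the Koszul cohomology of \<open>N/L\<close> with
  respect to generators \<open>x\<^sub>1, \<dots>, x\<^sub>r\<close> of \<open>J\<close> is nonzero, and it is at most \<open>r\<close> unless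
  \<open>N = L + JN\<close>. For \<open>N = U + I\<^sup>n V\<close> and \<open>L = I\<^sup>n W\<close> an Artin-Rees argument shows that the cocycles in
  a fixed degree have the form \<open>A + I\<^bsup>n-c\<^esup>B\<close> for large \<open>n\<close>, whereas the coboundaries together
  with the cochains of \<open>L\<close> are \<open>C + I\<^sup>n D\<close>. The inclusion \<open>A \<subseteq> C + I\<^sup>n D\<close> can only turn from true to
  false as \<open>n\<close> grows, and \<open>I\<^bsup>n-c\<^esup>B \<subseteq> C + I\<^sup>n D\<close> only from false to true, so the vanishing of the
  cohomology in each of the finitely many relevant degrees is eventually constant.\<close>

section \<open>Products of ideals and submodules, Noetherian modules\<close>

text \<open>The summand \<open>U\<close> is the same for every \<open>n\<close>, so the cocycles do
  not lie in I^n X for a fixed X, and Artin-Rees cannot be applied to them as they stand. It is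
  applied to two auxiliary families, one inside I^n V and one inside I^n W, cut out by conditions
  that themselves depend on \<open>n\<close>; this is why Artin-Rees is proved for arbitrary
  families S_n in I^n X with I S_n in S_(n+1). Koszul cohomology suits the problem because its
  cochains are finitely many copies of the coefficient module, so that forming them commutes with
  sums and with I^n, and because one differential, independent of \<open>n\<close>, serves all the
  quotients. The bound by the number of generators of \<open>J\<close> allows a common threshold:
  each degree has its own, and only finitely many have to be compared. Quotients never appear as
  types; an equation in N/L is an equation modulo L between elements of N.\<close>

lemma module_mult: "module ((*) :: 'a::comm_ring_1 \<Rightarrow> 'a \<Rightarrow> 'a)"
  by standard (auto simp: algebra_simps)

definition noetherian_module :: "('a::comm_ring_1 \<Rightarrow> 'b::ab_group_add \<Rightarrow> 'b) \<Rightarrow> 'b set \<Rightarrow> bool" where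
  "noetherian_module scale X \<longleftrightarrow>
     (\<forall>Y. module.subspace scale Y \<longrightarrow> Y \<subseteq> X \<longrightarrow> fin_gen scale Y)"

context module
begin

lemma subspace_msum: "subspace (msum scale A B)"
  by (simp add: msum_def)

lemma mem_msum:
  assumes "subspace A" and "subspace B"
  shows "x \<in> msum scale A B \<longleftrightarrow> (\<exists>a\<in>A. \<exists>b\<in>B. x = a + b)"
  using assms unfolding msum_def span_Un by (auto simp: span_eq_iff[THEN iffD2])

lemma msum_least: "subspace C \<Longrightarrow> A \<subseteq> C \<Longrightarrow> B \<subseteq> C \<Longrightarrow> msum scale A B \<subseteq> C"
  unfolding msum_def by (intro span_minimal) auto

lemma msum_upper1: "A \<subseteq> msum scale A B"
  unfolding msum_def by (meson Un_upper1 order_trans span_superset)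

lemma msum_upper2: "B \<subseteq> msum scale A B"
  unfolding msum_def by (meson Un_upper2 order_trans span_superset)

lemma msum_mono: "A \<subseteq> A' \<Longrightarrow> B \<subseteq> B' \<Longrightarrow> msum scale A B \<subseteq> msum scale A' B'"
  unfolding msum_def by (intro span_mono) auto

lemma msum_memI: "a \<in> A \<Longrightarrow> b \<in> B \<Longrightarrow> a + b \<in> msum scale A B"
  by (meson msum_upper1 msum_upper2 subsetD subspace_add subspace_msum)

lemma msum_assoc: "msum scale (msum scale A B) C = msum scale A (msum scale B C)"
  by (intro equalityI msum_least subspace_msum)
    (meson msum_upper1 msum_upper2 order_trans)+

lemma subspace_smod: "subspace (smod scale A X)"
  by (simp add: smod_def)

lemma smodI: "a \<in> A \<Longrightarrow> x \<in> X \<Longrightarrow> a *s x \<in> smod scale A X"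
  unfolding smod_def by (rule span_base) auto

lemma smod_least: "subspace Y \<Longrightarrow> (\<And>a x. a \<in> A \<Longrightarrow> x \<in> X \<Longrightarrow> a *s x \<in> Y) \<Longrightarrow> smod scale A X \<subseteq> Y"
  unfolding smod_def by (intro span_minimal) auto

lemma smod_mono: "A \<subseteq> B \<Longrightarrow> X \<subseteq> Y \<Longrightarrow> smod scale A X \<subseteq> smod scale B Y"
  by (intro smod_least subspace_smod smodI) auto

lemma smod_subset: "subspace X \<Longrightarrow> smod scale A X \<subseteq> X"
  by (intro smod_least) (auto intro: subspace_scale)

lemma smod_msum:
  assumes "subspace X" "subspace Y"
  shows "smod scale A (msum scale X Y) = msum scale (smod scale A X) (smod scale A Y)"
proof (intro equalityI smod_least subspace_msum)
  fix a x assume "a \<in> A" "x \<in> msum scale X Y"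
  then show "a *s x \<in> msum scale (smod scale A X) (smod scale A Y)"
    using assms by (auto simp: mem_msum scale_right_distrib intro!: msum_memI smodI)
qed (intro msum_least subspace_smod smod_mono order_refl msum_upper1 msum_upper2)

lemma module_hom_scale_self: "module_hom scale scale ((*s) c)"
  by unfold_locales (auto simp: scale_right_distrib mult.commute)

lemma subspace_preimage:
  assumes "module_hom scale scale D" "subspace Y"
  shows "subspace {x. D x \<in> Y}"
proof -
  interpret D: module_hom scale scale D by fact
  show ?thesis using assms(2)
    by (auto intro!: subspaceI simp: D.add D.scale D.zero subspace_0 subspace_add subspace_scale)
qed

lemma subspace_image:
  assumes "module_hom scale scale D" "subspace Y"
  shows "subspace (D ` Y)"
  using assms module_hom.subspace_image by blast

lemma image_smod:
  assumes "module_hom scale scale D"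
  shows "D ` smod scale A X = smod scale A (D ` X)"
proof -
  interpret D: module_hom scale scale D by fact
  show ?thesis
  proof (intro equalityI smod_least)
    have "smod scale A X \<subseteq> {x. D x \<in> smod scale A (D ` X)}"
      by (intro smod_least subspace_preimage assms subspace_smod) (auto simp: D.scale intro: smodI)
    then show "D ` smod scale A X \<subseteq> smod scale A (D ` X)" by auto
    show "subspace (D ` smod scale A X)"
      by (intro subspace_image assms subspace_smod)
    show "a *s x \<in> D ` smod scale A X" if "a \<in> A" "x \<in> D ` X" for a x
      using that by (force simp: D.scale[symmetric] intro: smodI)
  qed
qed

lemma image_msum:
  assumes "module_hom scale scale D" "subspace X" "subspace Y"
  shows "D ` msum scale X Y = msum scale (D ` X) (D ` Y)"
proof -
  interpret D: module_hom scale scale D by fact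
  have "subspace (D ` X)" "subspace (D ` Y)"
    using assms subspace_image by blast+
  moreover have "D a + D b \<in> D ` msum scale X Y" if "a \<in> X" "b \<in> Y" for a b
    using msum_memI[OF that] D.add by (metis imageI)
  ultimately show ?thesis
    using assms by (auto simp: mem_msum D.add) blast
qed

lemma smod_generators:
  assumes "subspace X"
  shows "smod scale (module.span (*) F) X = smod scale F X"
proof -
  interpret ring: module "(*) :: 'a \<Rightarrow> 'a \<Rightarrow> 'a" by (rule module_mult)
  show ?thesis
  proof (intro equalityI smod_least[of "smod scale F X"] subspace_smod)
    show "smod scale F X \<subseteq> smod scale (ring.span F) X"
      by (intro smod_mono order_refl ring.span_superset)
    fix c x assume c: "c \<in> ring.span F" and x: "x \<in> X"
    show "c *s x \<in> smod scale F X"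
      using c
    proof (induction rule: ring.span_induct_alt)
      case (step c a b)
      then show ?case
        using x by (simp add: scale_left_distrib)
          (metis scale_scale smodI subspace_add subspace_scale subspace_smod)
    qed (simp add: subspace_0 subspace_smod)
  qed
qed

text \<open>Powers of the ideal are traded for iterated multiplication by it, so that later
  inductions on the exponent peel off one factor and never look inside
  \<open>ideal_pow\<close>.\<close>

lemma smod_ideal_pow:
  assumes "subspace X"
  shows "smod scale (ideal_pow A n) X = (smod scale A ^^ n) X"
proof (induction n)
  case 0
  have "x \<in> smod scale UNIV X" if "x \<in> X" for x
    using smodI[of 1 UNIV x X] that by simp
  then show ?case using smod_subset[OF assms, of UNIV] by auto
next
  case (Suc n)
  have "smod scale {a * b |a b. a \<in> ideal_pow A n \<and> b \<in> A} X =
      smod scale A (smod scale (ideal_pow A n) X)"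
  proof (intro equalityI smod_least subspace_smod)
    fix c x assume "c \<in> {a * b |a b. a \<in> ideal_pow A n \<and> b \<in> A}" "x \<in> X"
    then obtain a b where "c = b * a" "a \<in> ideal_pow A n" "b \<in> A" "x \<in> X"
      by (auto simp: mult.commute)
    then show "c *s x \<in> smod scale A (smod scale (ideal_pow A n) X)"
      by (metis scale_scale smodI)
  next
    fix b y assume b: "b \<in> A" and y: "y \<in> smod scale (ideal_pow A n) X"
    let ?Y = "smod scale {a * b |a b. a \<in> ideal_pow A n \<and> b \<in> A} X"
    have "smod scale (ideal_pow A n) X \<subseteq> {y. b *s y \<in> ?Y}"
    proof (intro smod_least subspace_preimage module_hom_scale_self subspace_smod)
      fix a x assume "a \<in> ideal_pow A n" "x \<in> X"
      then have "(a * b) *s x \<in> ?Y" using b by (intro smodI) auto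
      then show "a *s x \<in> {y. b *s y \<in> ?Y}" by (simp add: mult.commute)
    qed
    with y show "b *s y \<in> ?Y" by auto
  qed
  with Suc show ?case
    by (simp add: smod_generators[OF assms])
qed

lemma subspace_smod_funpow: "subspace X \<Longrightarrow> subspace ((smod scale A ^^ n) X)"
  by (cases n) (simp_all add: subspace_smod)

lemma smod_funpow_mono: "X \<subseteq> Y \<Longrightarrow> (smod scale A ^^ n) X \<subseteq> (smod scale A ^^ n) Y"
  by (induction n) (simp_all add: smod_mono)

lemma smod_funpow_Suc_subset: "subspace X \<Longrightarrow> (smod scale A ^^ Suc n) X \<subseteq> (smod scale A ^^ n) X"
  by (simp add: smod_subset subspace_smod_funpow)

lemma smod_funpow_antimono:
  "subspace X \<Longrightarrow> m \<le> n \<Longrightarrow> (smod scale A ^^ n) X \<subseteq> (smod scale A ^^ m) X"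
  by (rule lift_Suc_antimono_le[of "\<lambda>n. (smod scale A ^^ n) X"]) (use smod_funpow_Suc_subset in auto)

lemma smod_funpow_msum:
  assumes "subspace X" "subspace Y"
  shows "(smod scale A ^^ n) (msum scale X Y) = msum scale ((smod scale A ^^ n) X) ((smod scale A ^^ n) Y)"
  by (induction n) (simp_all add: smod_msum subspace_smod_funpow assms)

lemma image_smod_funpow:
  assumes "module_hom scale scale D"
  shows "D ` (smod scale A ^^ n) X = (smod scale A ^^ n) (D ` X)"
  by (induction n) (simp_all add: image_smod[OF assms])

section \<open>Noetherian modules: chains, maximal members, finite generation\<close>

lemma noetherian_subset: "noetherian_module scale X \<Longrightarrow> Y \<subseteq> X \<Longrightarrow> noetherian_module scale Y"
  unfolding noetherian_module_def by blast

lemma subspace_Union_chain: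
  assumes "\<And>n::nat. subspace (L n)" and "\<And>n. L n \<subseteq> L (Suc n)"
  shows "subspace (\<Union>n. L n)"
proof (rule subspaceI)
  have mono: "L m \<subseteq> L n" if "m \<le> n" for m n
    using lift_Suc_mono_le[of L] assms(2) that by blast
  show "0 \<in> (\<Union>n. L n)" using assms(1) subspace_0 by blast
  show "x + y \<in> (\<Union>n. L n)" if xy: "x \<in> (\<Union>n. L n)" "y \<in> (\<Union>n. L n)" for x y
  proof -
    obtain m n where "x \<in> L m" "y \<in> L n" using xy by auto
    then have "x \<in> L (max m n)" "y \<in> L (max m n)"
      using mono[of m "max m n"] mono[of n "max m n"] by auto
    then show ?thesis using assms(1) subspace_add by blast
  qed
  show "c *s x \<in> (\<Union>n. L n)" if "x \<in> (\<Union>n. L n)" for c x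
    using that assms(1) subspace_scale by blast
qed

lemma noetherian_chain:
  assumes X: "noetherian_module scale X" and L: "\<And>n::nat. subspace (L n)" "\<And>n. L n \<subseteq> L (Suc n)" "\<And>n. L n \<subseteq> X"
  obtains k where "(\<Union>n. L n) = L k"
proof -
  have mono: "L m \<subseteq> L n" if "m \<le> n" for m n
    using lift_Suc_mono_le[of L] L(2) that by blast
  have "fin_gen scale (\<Union>n. L n)"
    using X L subspace_Union_chain[of L] unfolding noetherian_module_def by blast
  then obtain F where F: "finite F" "(\<Union>n. L n) = span F"
    unfolding fin_gen_def by blast
  then have "\<exists>k. x \<in> L k" if "x \<in> F" for x
    using span_base that by blast
  then obtain k where k: "\<And>x. x \<in> F \<Longrightarrow> x \<in> L (k x)" by metis
  define K where "K = Max (k ` F)"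
  have "F \<subseteq> L K"
  proof
    fix x assume "x \<in> F"
    then have "k x \<le> K" unfolding K_def using F(1) by simp
    with k[OF \<open>x \<in> F\<close>] mono show "x \<in> L K" by blast
  qed
  then have "(\<Union>n. L n) \<subseteq> L K"
    using F(2) L(1) span_minimal by metis
  with that show ?thesis by blast
qed

text \<open>Without a maximal member, dependent choice would produce a strictly ascending chain. It
  is applied both to annihilator ideals and to submodules.\<close>

lemma noetherian_maximal:
  assumes X: "noetherian_module scale X" and A: "\<A> \<noteq> {}" "\<And>Y. Y \<in> \<A> \<Longrightarrow> subspace Y \<and> Y \<subseteq> X"
  obtains Y where "Y \<in> \<A>" "\<And>Z. Z \<in> \<A> \<Longrightarrow> Y \<subseteq> Z \<Longrightarrow> Z = Y"
proof (rule ccontr)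
  assume "\<not> thesis"
  then have "\<forall>Y\<in>\<A>. \<exists>Z\<in>\<A>. Y \<subset> Z" using that by blast
  moreover obtain Y0 where "Y0 \<in> \<A>" using A(1) by blast
  ultimately obtain L where L: "\<And>n::nat. L n \<in> \<A>" "\<And>n. L n \<subset> L (Suc n)"
    using dependent_nat_choice[of "\<lambda>n Y. Y \<in> \<A>" "\<lambda>n Y Z. Y \<subset> Z"] by (metis (no_types))
  obtain k where "(\<Union>n. L n) = L k"
    by (rule noetherian_chain[OF X, of L]) (use A(2) L in blast)+
  with L(2)[of k] show False by blast
qed

text \<open>A submodule of \<open>Rx + N\<close> is generated by lifts of generators of its ideal of
  \<open>x\<close>-coefficients together with generators of its intersection with \<open>N\<close>.\<close>

lemma noetherian_span_finite:
  assumes R: "noetherian_ring TYPE('a)" and F: "finite F"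
  shows "noetherian_module scale (span F)"
  using F
proof (induction F)
  case empty
  show ?case unfolding noetherian_module_def fin_gen_def
    by (metis finite.emptyI span_empty subset_singletonD subspace_0 empty_iff)
next
  case (insert x F)
  interpret ring: module "(*) :: 'a \<Rightarrow> 'a \<Rightarrow> 'a" by (rule module_mult)
  show ?case unfolding noetherian_module_def
  proof (intro allI impI)
    fix Y assume Y: "subspace Y" "Y \<subseteq> span (insert x F)"
    define A where "A = {c. \<exists>y\<in>Y. y - c *s x \<in> span F}"
    have "ring.subspace A"
    proof (rule ring.subspaceI)
      show "0 \<in> A" using subspace_0[OF Y(1)] span_zero unfolding A_def by force
      show "c + d \<in> A" if cd: "c \<in> A" "d \<in> A" for c d
      proof -
        from cd obtain y z where "y \<in> Y" "z \<in> Y" "y - c *s x \<in> span F" "z - d *s x \<in> span F"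
          unfolding A_def by blast
        moreover from this have "(y + z) - (c + d) *s x \<in> span F"
          using span_add[of "y - c *s x" F "z - d *s x"] by (simp add: algebra_simps)
        ultimately show ?thesis unfolding A_def using subspace_add[OF Y(1)] by blast
      qed
      show "c * d \<in> A" if d: "d \<in> A" for c d
      proof -
        from d obtain y where "y \<in> Y" "y - d *s x \<in> span F" unfolding A_def by blast
        moreover from this have "c *s y - (c * d) *s x \<in> span F"
          using span_scale[of "y - d *s x" F c] by (simp add: scale_right_diff_distrib)
        ultimately show ?thesis unfolding A_def using subspace_scale[OF Y(1)] by blast
      qed
    qed
    then obtain C where C: "finite C" "A = ring.span C"
      using R unfolding noetherian_ring_def ideal_def by blast
    then have "\<forall>c\<in>C. \<exists>y. y \<in> Y \<and> y - c *s x \<in> span F"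
      using ring.span_base unfolding A_def by blast
    then obtain y where y: "\<And>c. c \<in> C \<Longrightarrow> y c \<in> Y \<and> y c - c *s x \<in> span F" by metis
    have "fin_gen scale (Y \<inter> span F)"
      using insert.IH Y(1) unfolding noetherian_module_def by (simp add: subspace_inter)
    then obtain G where G: "finite G" "Y \<inter> span F = span G"
      unfolding fin_gen_def by blast
    have lift: "\<exists>z\<in>span (y ` C). z - c *s x \<in> span F" if "c \<in> ring.span C" for c
      using that
    proof (induction rule: ring.span_induct_alt)
      case base
      show ?case by (rule bexI[of _ 0]) (auto simp: span_zero)
    next
      case (step d a b)
      then obtain z where z: "z \<in> span (y ` C)" "z - b *s x \<in> span F" by blast
      have "d *s y a + z - (d * a + b) *s x = d *s (y a - a *s x) + (z - b *s x)"
        by (simp add: algebra_simps)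
      moreover have "\<dots> \<in> span F"
        using y[OF step(1)] z by (intro span_add span_scale) auto
      ultimately have "d *s y a + z - (d * a + b) *s x \<in> span F" by (simp only:)
      moreover have "d *s y a + z \<in> span (y ` C)"
        using step(1) z(1) by (simp add: span_add span_scale span_base)
      ultimately show ?case by blast
    qed
    have "Y = span (G \<union> y ` C)"
    proof
      show "span (G \<union> y ` C) \<subseteq> Y"
        using G y Y(1) by (intro span_minimal) (auto intro: span_base)
      show "Y \<subseteq> span (G \<union> y ` C)"
      proof
        fix v assume v: "v \<in> Y"
        then obtain c where c: "v - c *s x \<in> span F"
          using Y(2) span_breakdown_eq by blast
        with v have "c \<in> ring.span C" using C unfolding A_def by blast
        then obtain z where z: "z \<in> span (y ` C)" "z - c *s x \<in> span F" using lift by blast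
        have "z \<in> Y" using z(1) y Y(1) span_minimal[of "y ` C" Y] by blast
        moreover have "v - z \<in> span F"
          using span_diff[OF c z(2)] by simp
        ultimately have "v - z \<in> span G"
          using G v Y(1) subspace_diff by blast
        then have "(v - z) + z \<in> span (G \<union> y ` C)"
          using z(1) span_mono[of G "G \<union> y ` C"] span_mono[of "y ` C" "G \<union> y ` C"]
          by (intro span_add) auto
        then show "v \<in> span (G \<union> y ` C)" by simp
      qed
    qed
    then show "fin_gen scale Y"
      using G(1) C(1) unfolding fin_gen_def by (intro exI[of _ "G \<union> y ` C"]) simp
  qed
qed

end

section \<open>The Artin-Rees lemma for families of submodules\<close>

text \<open>In terms of the Rees algebra: the part of total degree \<open>n\<close> whose degree in
  the adjoined variable \<open>a\<close> is less than \<open>k\<close>, that is, the sum of the a^j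
  M(n-j) with j < k. The truncated difference is a true one only for j up to \<open>n\<close>, hence
  the bound \<open>k \<le> Suc n\<close> below.\<close>

primrec rees_below ::
  "('a::comm_ring_1 \<Rightarrow> 'b::ab_group_add \<Rightarrow> 'b) \<Rightarrow> 'a \<Rightarrow> (nat \<Rightarrow> 'b set) \<Rightarrow> nat \<Rightarrow> nat \<Rightarrow> 'b set" where
  "rees_below scale a M n 0 = {0}"
| "rees_below scale a M n (Suc k) = msum scale (scale (a ^ k) ` M (n - k)) (rees_below scale a M n k)"

context module
begin

lemma subspace_rees_below: "subspace (rees_below scale a M n k)"
  by (cases k) (simp_all add: subspace_msum)

lemma mem_rees_below_Suc:
  assumes "subspace (M (n - k))"
  shows "x \<in> rees_below scale a M n (Suc k) \<longleftrightarrow>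
    (\<exists>m\<in>M (n - k). \<exists>y\<in>rees_below scale a M n k. x = a ^ k *s m + y)"
  using assms by (simp add: mem_msum subspace_image[OF module_hom_scale_self] subspace_rees_below)

lemma rees_below_mono: "k \<le> l \<Longrightarrow> rees_below scale a M n k \<subseteq> rees_below scale a M n l"
  by (rule lift_Suc_mono_le[of "rees_below scale a M n"]) (simp add: msum_upper2)

lemma rees_below_shift:
  assumes M: "\<And>n. subspace (M n)"
  shows "x \<in> rees_below scale a M n k \<Longrightarrow> a *s x \<in> rees_below scale a M (Suc n) (Suc k)"
proof (induction k arbitrary: x)
  case 0
  then show ?case using subspace_0[OF subspace_rees_below, of a M "Suc n" "Suc 0"] by simp
next
  case (Suc k)
  then obtain m y where my: "m \<in> M (n - k)" "y \<in> rees_below scale a M n k" "x = a ^ k *s m + y"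
    using mem_rees_below_Suc[of M, OF M] by blast
  then have "a *s x = a ^ Suc k *s m + a *s y"
    by (simp add: scale_right_distrib)
  with my Suc.IH[OF my(2)] show ?case
    unfolding mem_rees_below_Suc[of M "Suc n" "Suc k", OF M] by auto
qed

lemma rees_below_scale:
  assumes M: "\<And>n. subspace (M n)" "\<And>n m. m \<in> M n \<Longrightarrow> b *s m \<in> M (Suc n)"
  shows "k \<le> Suc n \<Longrightarrow> x \<in> rees_below scale a M n k \<Longrightarrow> b *s x \<in> rees_below scale a M (Suc n) k"
proof (induction k arbitrary: x)
  case 0
  then show ?case by simp
next
  case (Suc k)
  then obtain m y where my: "m \<in> M (n - k)" "y \<in> rees_below scale a M n k" "x = a ^ k *s m + y"
    using mem_rees_below_Suc[of M, OF M(1)] by blast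
  then have "b *s x = a ^ k *s (b *s m) + b *s y"
    by (simp add: scale_right_distrib mult.commute)
  moreover have "b *s m \<in> M (Suc n - k)"
    using M(2)[OF my(1)] Suc.prems(1) by (simp add: Suc_diff_le)
  moreover have "b *s y \<in> rees_below scale a M (Suc n) k"
    using Suc my(2) by simp
  ultimately show ?case
    unfolding mem_rees_below_Suc[of M "Suc n" k, OF M(1)] by blast
qed

text \<open>A product of \<open>n\<close> factors from \<open>insert a F\<close> contains
  \<open>a\<close> some j times and leaves n-j factors from \<open>F\<close>; the last index
  \<open>Suc n\<close> admits every j up to \<open>n\<close>.\<close>

lemma smod_insert_funpow_subset:
  assumes X: "subspace X"
  shows "(smod scale (insert a F) ^^ n) X \<subseteq> rees_below scale a (\<lambda>n. (smod scale F ^^ n) X) n (Suc n)"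
proof (induction n)
  case 0
  show ?case using msum_upper1[of X "{0}"] by simp
next
  case (Suc n)
  let ?M = "\<lambda>n. (smod scale F ^^ n) X"
  have M: "\<And>n. subspace (?M n)"
    using X by (rule subspace_smod_funpow)
  have "smod scale (insert a F) ((smod scale (insert a F) ^^ n) X) \<subseteq> rees_below scale a ?M (Suc n) (Suc (Suc n))"
  proof (intro smod_least subspace_rees_below)
    fix b x assume b: "b \<in> insert a F" and "x \<in> (smod scale (insert a F) ^^ n) X"
    then have x: "x \<in> rees_below scale a ?M n (Suc n)" using Suc by blast
    show "b *s x \<in> rees_below scale a ?M (Suc n) (Suc (Suc n))"
    proof (cases "b = a")
      case True
      then show ?thesis using rees_below_shift[of ?M, OF M x] by simp
    next
      case False
      with b have "b *s x \<in> rees_below scale a ?M (Suc n) (Suc n)"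
        by (intro rees_below_scale[of ?M, OF M _ _ x]) (auto intro: smodI)
      then show ?thesis using rees_below_mono[OF le_SucI[OF order_refl]] by blast
    qed
  qed
  then show ?case by simp
qed

text \<open>When \<open>c\<close> is a power of \<open>a\<close> and \<open>B\<close> holds the
  terms of lower order in \<open>a\<close>, these are the leading coefficients of elements of
  \<open>A\<close>.\<close>

lemma subspace_leading:
  assumes "subspace A" "subspace B"
  shows "subspace {m. \<exists>s\<in>A. s - c *s m \<in> B}"
proof (rule subspaceI)
  show "0 \<in> {m. \<exists>s\<in>A. s - c *s m \<in> B}"
    using assms subspace_0 by force
next
  fix m n assume "m \<in> {m. \<exists>s\<in>A. s - c *s m \<in> B}" "n \<in> {m. \<exists>s\<in>A. s - c *s m \<in> B}"
  then obtain s t where "s \<in> A" "t \<in> A" "s - c *s m \<in> B" "t - c *s n \<in> B" by blast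
  then have "s + t \<in> A" "(s + t) - c *s (m + n) \<in> B"
    using assms subspace_add[OF assms(2), of "s - c *s m" "t - c *s n"]
    by (auto simp: subspace_add algebra_simps)
  then show "m + n \<in> {m. \<exists>s\<in>A. s - c *s m \<in> B}" by blast
next
  fix d m assume "m \<in> {m. \<exists>s\<in>A. s - c *s m \<in> B}"
  then obtain s where "s \<in> A" "s - c *s m \<in> B" by blast
  then have "d *s s \<in> A" "d *s s - c *s (d *s m) \<in> B"
    using assms subspace_scale[OF assms(2), of "s - c *s m" d]
    by (auto simp: subspace_scale algebra_simps)
  then show "d *s m \<in> {m. \<exists>s\<in>A. s - c *s m \<in> B}" by blast
qed

text \<open>Hilbert's basis argument, carried out inside the module instead of in a polynomial or Rees
  ring. When \<open>a\<close> is adjoined to \<open>F\<close>, an element of \<open>(F \<union> {a})\<^sup>n X\<close> is written as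
  \<open>\<Sum>\<^sub>j a\<^sup>j m\<^sub>j\<close> with \<open>m\<^sub>j \<in> F\<^bsup>n-j\<^esup> X\<close>, and the leading coefficients of elements of
  \<open>S\<close> form an ascending chain of families to which the induction hypothesis applies.\<close>

lemma artin_rees_family_finite:
  assumes F: "finite F" and X: "subspace X" "noetherian_module scale X"
    and S: "\<And>n. subspace (S n)" "\<And>n. S n \<subseteq> (smod scale F ^^ n) X" "\<And>n. smod scale F (S n) \<subseteq> S (Suc n)"
  shows "\<exists>c. \<forall>n\<ge>c. S (Suc n) \<subseteq> smod scale F (S n)"
  using F S
proof (induction F arbitrary: S)
  case empty
  have "(smod scale {} ^^ Suc n) X = {0}" for n
    by (simp add: smod_def)
  with empty(2) have "S (Suc n) \<subseteq> {0}" for n by blast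
  then show ?case
    by (metis bot.extremum insert_subset order_trans subspace_0 subspace_smod)
next
  case (insert a F)
  define M where "M n = (smod scale F ^^ n) X" for n
  define G where "G n k = rees_below scale a M n k" for n k
  \<comment> \<open>The coefficients of a^k in elements of \<open>S (n + k)\<close> without higher
    powers of \<open>a\<close>. For fixed \<open>k\<close> this is an \<open>F\<close>-stable family
    in \<open>n\<close>; for fixed \<open>n\<close> it grows with \<open>k\<close>, since
    multiplying \<open>s\<close> by \<open>a\<close> raises its order by one.\<close>
  define L where "L k n = M n \<inter> {m. \<exists>s\<in>S (n + k). s - a ^ k *s m \<in> G (n + k) k}" for k n
  let ?I = "insert a F"
  note S = insert.prems
  have M: "subspace (M n)" for n
    unfolding M_def using X(1) by (rule subspace_smod_funpow)
  have MX: "M n \<subseteq> X" for n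
    using smod_funpow_antimono[OF X(1) le0, of n F] unfolding M_def by simp
  have M_scale: "b *s m \<in> M (Suc n)" if "b \<in> F" "m \<in> M n" for b m n
    using that unfolding M_def by (auto intro: smodI)
  have G: "subspace (G n k)" for n k
    unfolding G_def by (rule subspace_rees_below)
  have G_shift: "a *s x \<in> G (Suc n) (Suc k)" if "x \<in> G n k" for x n k
    using that M rees_below_shift unfolding G_def by blast
  have G_scale: "b *s x \<in> G (Suc n) k" if "b \<in> F" "k \<le> Suc n" "x \<in> G n k" for b x n k
    using that M M_scale rees_below_scale unfolding G_def by blast
  have SG: "S n \<subseteq> G n (Suc n)" for n
    using S(2)[of n] smod_insert_funpow_subset[OF X(1), of n a F] unfolding G_def M_def by blast
  have S_scale: "b *s s \<in> S (Suc n)" if "b \<in> ?I" "s \<in> S n" for b s n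
    using S(3)[of n] that smodI by blast
  have L: "subspace (L k n)" for k n
    unfolding L_def by (intro subspace_inter M subspace_leading S(1) G)
  have L_F: "smod scale F (L k n) \<subseteq> L k (Suc n)" for k n
  proof (intro smod_least L)
    fix b m assume b: "b \<in> F" and m: "m \<in> L k n"
    then obtain s where s: "m \<in> M n" "s \<in> S (n + k)" "s - a ^ k *s m \<in> G (n + k) k"
      unfolding L_def by blast
    have "b *s s - a ^ k *s (b *s m) = b *s (s - a ^ k *s m)"
      by (simp add: scale_right_diff_distrib mult.commute)
    then have "b *s s - a ^ k *s (b *s m) \<in> G (Suc n + k) k"
      using G_scale[OF b _ s(3)] by simp
    moreover have "b *s s \<in> S (Suc n + k)"
      using S_scale[of b s] b s(2) by simp
    ultimately show "b *s m \<in> L k (Suc n)"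
      unfolding L_def using M_scale[OF b s(1)] by blast
  qed
  have L_Suc: "L k n \<subseteq> L (Suc k) n" for k n
  proof
    fix m assume "m \<in> L k n"
    then obtain s where s: "m \<in> M n" "s \<in> S (n + k)" "s - a ^ k *s m \<in> G (n + k) k"
      unfolding L_def by blast
    have "a *s s - a ^ Suc k *s m = a *s (s - a ^ k *s m)"
      by (simp add: scale_right_diff_distrib)
    then have "a *s s - a ^ Suc k *s m \<in> G (n + Suc k) (Suc k)"
      using G_shift[OF s(3)] by simp
    moreover have "a *s s \<in> S (n + Suc k)"
      using S_scale[of a s] s(2) by simp
    ultimately show "m \<in> L (Suc k) n"
      unfolding L_def using s(1) by blast
  qed
  have L_mono: "L k n \<subseteq> L l n" if "k \<le> l" for k l n
    using lift_Suc_mono_le[of "\<lambda>k. L k n"] L_Suc that by blast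
  have "\<exists>c. \<forall>n\<ge>c. L k (Suc n) \<subseteq> smod scale F (L k n)" for k
    using L L_F by (intro insert.IH) (auto simp: L_def M_def)
  then obtain c where c: "\<And>k n. c k \<le> n \<Longrightarrow> L k (Suc n) \<subseteq> smod scale F (L k n)"
    by metis
  define Linf where "Linf n = (\<Union>k. L k n)" for n
  have Linf: "subspace (Linf n)" for n
    unfolding Linf_def by (intro subspace_Union_chain L L_Suc)
  have "\<exists>c. \<forall>n\<ge>c. Linf (Suc n) \<subseteq> smod scale F (Linf n)"
  proof (rule insert.IH[OF Linf])
    show "Linf n \<subseteq> (smod scale F ^^ n) X" for n
      unfolding Linf_def L_def M_def by blast
    show "smod scale F (Linf n) \<subseteq> Linf (Suc n)" for n
    proof (intro smod_least Linf)
      fix b m assume b: "b \<in> F" and "m \<in> Linf n"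
      then obtain k where "m \<in> L k n" unfolding Linf_def by blast
      then have "b *s m \<in> L k (Suc n)"
        using L_F[of k n] smodI[OF b] by blast
      then show "b *s m \<in> Linf (Suc n)" unfolding Linf_def by blast
    qed
  qed
  then obtain d where d: "\<And>n. d \<le> n \<Longrightarrow> Linf (Suc n) \<subseteq> smod scale F (Linf n)" by blast
  have "\<exists>k. Linf n = L k n" for n
  proof -
    have "L k n \<subseteq> X" for k using MX unfolding L_def by blast
    then obtain k where "(\<Union>k. L k n) = L k n"
      using noetherian_chain[of X "\<lambda>k. L k n", OF X(2) L L_Suc] by blast
    then show ?thesis unfolding Linf_def by blast
  qed
  then obtain e where e: "\<And>n. Linf n = L (e n) n" by metis
  \<comment> \<open>For each \<open>n\<close> the chain in \<open>k\<close> becomes stationary at a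
    place depending on \<open>n\<close>. The finitely many \<open>n \<le> d\<close> determine
    \<open>K\<close>; beyond \<open>d\<close> each level of \<open>Linf\<close> is generated by the
    preceding one, so the same \<open>K\<close> still suffices.\<close>
  define K where "K = Max (e ` {..d})"
  have LK: "Linf n \<subseteq> L K n" for n
  proof (induction n)
    case 0
    have "e 0 \<le> K" unfolding K_def by simp
    then show ?case using e L_mono by blast
  next
    case (Suc n)
    show ?case
    proof (cases "Suc n \<le> d")
      case True
      then have "e (Suc n) \<le> K" unfolding K_def by simp
      then show ?thesis using e L_mono by blast
    next
      case False
      then have "Linf (Suc n) \<subseteq> smod scale F (Linf n)" by (intro d) simp
      also have "\<dots> \<subseteq> smod scale F (L K n)" using Suc by (intro smod_mono) auto
      also have "\<dots> \<subseteq> L K (Suc n)" by (rule L_F)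
      finally show ?thesis .
    qed
  qed
  define C where "C = Max (c ` {..K})"
  have cC: "c k \<le> C" if "k \<le> K" for k
    unfolding C_def using that by simp
  \<comment> \<open>Induction on the order in \<open>a\<close>: an element of
    \<open>smod scale ?I (S n)\<close> with the same leading coefficient is subtracted, and the
    remainder has lower order. The bound \<open>K + C\<close> ensures that \<open>n - k\<close> is
    at least \<open>C\<close> for all \<open>k \<le> K\<close>.\<close>
  have main: "s \<in> smod scale ?I (S n)"
    if n: "K + C \<le> n" and "k \<le> Suc (Suc n)" "s \<in> S (Suc n)" "s \<in> G (Suc n) k" for n k s
    using that(2-)
  proof (induction k arbitrary: s)
    case 0
    then show ?case by (simp add: G_def subspace_0 subspace_smod)
  next
    case (Suc k)
    then have k: "k \<le> Suc n" by simp
    from Suc.prems obtain m g where mg: "m \<in> M (Suc n - k)" "g \<in> G (Suc n) k" "s = a ^ k *s m + g"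
      using mem_rees_below_Suc[of M, OF M] unfolding G_def by blast
    have mL: "m \<in> L k (Suc n - k)"
      unfolding L_def using mg Suc.prems k by (auto intro!: bexI[of _ s])
    have "\<exists>s'\<in>smod scale ?I (S n). s' - a ^ k *s m \<in> G (Suc n) k"
    \<comment> \<open>Beyond \<open>K\<close> the coefficient already occurs in order
      \<open>k - 1\<close>, and a factor \<open>a\<close> raises it to order \<open>k\<close>. Up to
      \<open>K\<close> the family \<open>L k\<close> is already generated by \<open>F\<close> from
      the level \<open>n - k\<close>.\<close>
    proof (cases "K < k")
      case True
      then obtain l where l: "k = Suc l" "K \<le> l" by (cases k) auto
      have "m \<in> L l (Suc n - k)"
        using mL LK[of "Suc n - k"] L_mono[OF l(2)] unfolding Linf_def by blast
      then obtain s' where s': "s' \<in> S n" "s' - a ^ l *s m \<in> G n l"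
        using l k unfolding L_def by auto
      have "a *s s' - a ^ k *s m = a *s (s' - a ^ l *s m)"
        by (simp add: l scale_right_diff_distrib)
      then have "a *s s' - a ^ k *s m \<in> G (Suc n) k"
        using G_shift[OF s'(2)] l by simp
      moreover have "a *s s' \<in> smod scale ?I (S n)"
        using s' by (intro smodI) auto
      ultimately show ?thesis by blast
    next
      case False
      then have cn: "c k \<le> n - k" and kn: "k \<le> n" using cC[of k] n by auto
      then have "m \<in> smod scale F (L k (n - k))"
        using mL c[OF cn] by (auto simp: Suc_diff_le)
      also have "\<dots> \<subseteq> {m. \<exists>s'\<in>smod scale ?I (S n). s' - a ^ k *s m \<in> G (Suc n) k}"
      proof (intro smod_least subspace_leading subspace_smod G)
        fix b m assume b: "b \<in> F" and m: "m \<in> L k (n - k)"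
        then obtain s' where s': "s' \<in> S n" "s' - a ^ k *s m \<in> G n k"
          using kn unfolding L_def by auto
        have "b *s s' - a ^ k *s (b *s m) = b *s (s' - a ^ k *s m)"
          by (simp add: scale_right_diff_distrib mult.commute)
        then have "b *s s' - a ^ k *s (b *s m) \<in> G (Suc n) k"
          using G_scale[OF b k s'(2)] by simp
        moreover have "b *s s' \<in> smod scale ?I (S n)"
          using s' b by (intro smodI) auto
        ultimately show "b *s m \<in> {m. \<exists>s'\<in>smod scale ?I (S n). s' - a ^ k *s m \<in> G (Suc n) k}"
          by blast
      qed
      finally show ?thesis by blast
    qed
    then obtain s' where s': "s' \<in> smod scale ?I (S n)" "s' - a ^ k *s m \<in> G (Suc n) k" by blast
    have "s - s' = g - (s' - a ^ k *s m)"
      using mg(3) by simp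
    then have "s - s' \<in> G (Suc n) k"
      using subspace_diff[OF G mg(2) s'(2)] by (simp only:)
    moreover have "s - s' \<in> S (Suc n)"
      using Suc.prems s'(1) S(3)[of n] by (intro subspace_diff S(1)) auto
    ultimately have "s - s' \<in> smod scale ?I (S n)"
      using Suc.IH k by simp
    then have "(s - s') + s' \<in> smod scale ?I (S n)"
      using s'(1) by (intro subspace_add subspace_smod)
    then show ?case by simp
  qed
  show ?case
    \<comment> \<open>By \<open>SG\<close>, every element of \<open>S (Suc n)\<close> has order less
      than \<open>Suc (Suc n)\<close>, so the induction may start there.\<close>
    using main[of _ "Suc (Suc _)"] SG by blast
qed

text \<open>The classical lemma is the case where \<open>S n\<close> is the intersection of I^n X
  with a fixed submodule; here that submodule may vary with \<open>n\<close>. Finitely many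
  generators of \<open>I\<close> give the same products, which reduces the claim to the finite
  case.\<close>

lemma artin_rees_family:
  assumes R: "noetherian_ring TYPE('a)" and I: "ideal I"
    and X: "subspace X" "noetherian_module scale X"
    and S: "\<And>n. subspace (S n)" "\<And>n. S n \<subseteq> (smod scale I ^^ n) X" "\<And>n. smod scale I (S n) \<subseteq> S (Suc n)"
  shows "\<exists>c. \<forall>n\<ge>c. S (Suc n) = smod scale I (S n)"
proof -
  obtain F where F: "finite F" "I = module.span (*) F"
    using R I unfolding noetherian_ring_def by blast
  have IF: "smod scale I Y = smod scale F Y" if "subspace Y" for Y
    using smod_generators[OF that] F(2) by simp
  have "(smod scale I ^^ n) X = (smod scale F ^^ n) X" for n
    by (induction n) (simp_all add: IF subspace_smod_funpow X)
  then have "\<exists>c. \<forall>n\<ge>c. S (Suc n) \<subseteq> smod scale F (S n)"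
    using S IF by (intro artin_rees_family_finite[OF F(1) X]) auto
  then show ?thesis
    using IF S by (metis subset_antisym)
qed

end

section \<open>Eventual constancy of exactness\<close>

definition eventually_const :: "(nat \<Rightarrow> 'c) \<Rightarrow> bool" where
  "eventually_const f \<longleftrightarrow> (\<exists>c. \<forall>\<^sub>F n in sequentially. f n = c)"

lemma eventually_const_comp:
  assumes "eventually_const f" "eventually_const g"
  shows "eventually_const (\<lambda>n. h (f n) (g n))"
proof -
  obtain c d where "\<forall>\<^sub>F n in sequentially. f n = c" "\<forall>\<^sub>F n in sequentially. g n = d"
    using assms unfolding eventually_const_def by blast
  then have "\<forall>\<^sub>F n in sequentially. h (f n) (g n) = h c d"
    by eventually_elim simp
  then show ?thesis unfolding eventually_const_def by blast
qed

lemma eventually_const_shift: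
  assumes "eventually_const (\<lambda>n. f (n + c))"
  shows "eventually_const f"
proof -
  obtain x m where "\<And>n. m \<le> n \<Longrightarrow> f (n + c) = x"
    using assms unfolding eventually_const_def eventually_sequentially by blast
  then have "f n = x" if "m + c \<le> n" for n
    using that by (metis add_le_imp_le_right le_add_diff_inverse2 le_trans le_add2)
  then show ?thesis unfolding eventually_const_def eventually_sequentially by blast
qed

lemma eventually_const_monotone:
  assumes "\<And>n. P n \<Longrightarrow> P (Suc n)"
  shows "eventually_const P"
proof (cases "\<exists>n. P n")
  case True
  then obtain m where "P m" by blast
  have "P n" if "m \<le> n" for n
    using that \<open>P m\<close> by (induction rule: dec_induct) (auto intro: assms)
  then show ?thesis unfolding eventually_const_def eventually_sequentially by blast
next
  case False
  then show ?thesis unfolding eventually_const_def by (intro exI[of _ False]) simp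
qed

lemma eventually_const_antitone:
  assumes "\<And>n. P (Suc n) \<Longrightarrow> P n"
  shows "eventually_const P"
proof -
  have "eventually_const (\<lambda>n. \<not> P n)"
    using assms by (intro eventually_const_monotone) blast
  then show ?thesis using eventually_const_comp[of "\<lambda>n. \<not> P n" "\<lambda>n. \<not> P n" "\<lambda>p q. \<not> p"] by simp
qed

text \<open>Only finitely many thresholds have to be passed, so the whole truncated function of
  \<open>i\<close> becomes constant as a single value. In this form an operation such as
  \<open>LEAST\<close> can be applied to it through \<open>eventually_const_comp\<close>.\<close>

lemma eventually_const_bounded_family:
  assumes "\<And>i. eventually_const (P i)"
  shows "eventually_const (\<lambda>n i. i \<le> (r::nat) \<and> P i n)"
proof -
  obtain c where c: "\<And>i. \<forall>\<^sub>F n in sequentially. P i n = c i"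
    using assms unfolding eventually_const_def by metis
  have "\<forall>\<^sub>F n in sequentially. \<forall>i\<in>{..r}. P i n = c i"
    using c by (intro eventually_ball_finite) auto
  then have "\<forall>\<^sub>F n in sequentially. (\<lambda>i. i \<le> r \<and> P i n) = (\<lambda>i. i \<le> r \<and> c i)"
    by eventually_elim auto
  then show ?thesis unfolding eventually_const_def by blast
qed

context module
begin

text \<open>\<open>A\<close> lies in \<open>C + I\<^bsup>n+c\<^esup>D\<close> for all \<open>n\<close> or fails to do so for all large \<open>n\<close>, because the right-hand
  side decreases; an inclusion of \<open>I\<^sup>n B\<close> in it survives multiplication by \<open>I\<close>.\<close>

lemma eventually_const_inclusion:
  assumes "subspace A" "subspace B" "subspace C" "subspace D"
  shows "eventually_const (\<lambda>n. msum scale A ((smod scale I ^^ n) B)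
    \<subseteq> msum scale C ((smod scale I ^^ (n + c)) D))"
proof -
  let ?R = "\<lambda>n. msum scale C ((smod scale I ^^ (n + c)) D)"
  have "?R (Suc n) \<subseteq> ?R n" for n
    using smod_funpow_Suc_subset[OF assms(4)] by (intro msum_mono) auto
  then have "eventually_const (\<lambda>n. A \<subseteq> ?R n)"
    by (intro eventually_const_antitone) blast
  moreover have "eventually_const (\<lambda>n. (smod scale I ^^ n) B \<subseteq> ?R n)"
  proof (intro eventually_const_monotone)
    fix n assume "(smod scale I ^^ n) B \<subseteq> ?R n"
    then have "(smod scale I ^^ Suc n) B \<subseteq> smod scale I (?R n)"
      by (simp add: smod_mono)
    also have "\<dots> = msum scale (smod scale I C) ((smod scale I ^^ (Suc n + c)) D)"
      using assms by (simp add: smod_msum subspace_smod_funpow)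
    also have "\<dots> \<subseteq> ?R (Suc n)"
      using assms by (intro msum_mono smod_subset) auto
    finally show "(smod scale I ^^ Suc n) B \<subseteq> ?R (Suc n)" .
  qed
  ultimately have "eventually_const (\<lambda>n. A \<subseteq> ?R n \<and> (smod scale I ^^ n) B \<subseteq> ?R n)"
    by (rule eventually_const_comp)
  moreover have "msum scale A ((smod scale I ^^ n) B) \<subseteq> ?R n \<longleftrightarrow>
      A \<subseteq> ?R n \<and> (smod scale I ^^ n) B \<subseteq> ?R n" for n
    using msum_upper1[of A "(smod scale I ^^ n) B"] msum_upper2[of "(smod scale I ^^ n) B" A]
      msum_least[OF subspace_msum, of A] by blast
  ultimately show ?thesis by simp
qed

section \<open>Cocycles and coboundaries along the filtration\<close>

lemma artin_rees_family_funpow: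
  assumes "\<forall>n\<ge>c. S (Suc n) = smod scale I (S n)" and "c \<le> d"
  shows "S (n + d) = (smod scale I ^^ n) (S d)"
  using assms by (induction n) auto

text \<open>Write f = u + v. Artin-Rees inside \<open>V\<close> exchanges v, up to an element of
  \<open>U\<close>, for some z in I^n Z(c). Then f - z lies in \<open>U\<close> and is still a
  cocycle modulo I^(n+c) W, and Artin-Rees inside \<open>W\<close> exchanges it, up to an element of
  \<open>U\<close> killed by \<open>D\<close>, for some y in I^n Z(c).\<close>

lemma cocycles_eventually:
  assumes R: "noetherian_ring TYPE('a)" and I: "ideal I" and D: "module_hom scale scale D"
    and U: "subspace U" and V: "subspace V" "noetherian_module scale V"
    and W: "subspace W" "noetherian_module scale W"
  defines "Z \<equiv> \<lambda>n. msum scale U ((smod scale I ^^ n) V) \<inter> {f. D f \<in> (smod scale I ^^ n) W}"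
  shows "\<exists>c. \<forall>n. Z (n + c) = msum scale (U \<inter> {f. D f = 0}) ((smod scale I ^^ n) (Z c))"
proof -
  interpret D: module_hom scale scale D by fact
  define V' where "V' n = (smod scale I ^^ n) V" for n
  define W' where "W' n = (smod scale I ^^ n) W" for n
  have sV': "subspace (V' n)" and sW': "subspace (W' n)" for n
    unfolding V'_def W'_def using V W subspace_smod_funpow by auto
  have V'_scale: "b *s v \<in> V' (Suc n)" if "b \<in> I" "v \<in> V' n" for b v n
    using that unfolding V'_def by (auto intro: smodI)
  have W'_scale: "b *s v \<in> W' (Suc n)" if "b \<in> I" "v \<in> W' n" for b v n
    using that unfolding W'_def by (auto intro: smodI)
  have Z: "Z n = msum scale U (V' n) \<inter> {f. D f \<in> W' n}" for n
    unfolding Z_def V'_def W'_def ..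
  have sZ: "subspace (Z n)" for n
    unfolding Z by (intro subspace_inter subspace_msum subspace_preimage D sW')
  have Z_step: "smod scale I (Z n) \<subseteq> Z (Suc n)" for n
  proof (intro smod_least sZ)
    fix b f assume b: "b \<in> I" and f: "f \<in> Z n"
    then obtain u v where "u \<in> U" "v \<in> V' n" "f = u + v" "D f \<in> W' n"
      unfolding Z using U sV' by (auto simp: mem_msum)
    then show "b *s f \<in> Z (Suc n)"
      unfolding Z using b U
      by (auto simp: scale_right_distrib D.add D.scale[symmetric] subspace_scale V'_scale intro!: msum_memI)
        (metis D.add D.scale W'_scale scale_right_distrib)
  qed
  have Z_funpow: "(smod scale I ^^ n) (Z c) \<subseteq> Z (n + c)" for n c
  proof (induction n)
    case (Suc n)
    then have "smod scale I ((smod scale I ^^ n) (Z c)) \<subseteq> smod scale I (Z (n + c))"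
      by (intro smod_mono) auto
    then show ?case using Z_step[of "n + c"] by simp
  qed simp
  \<comment> \<open>Exactly the components in I^n V that occur when elements of \<open>Z n\<close>
    are written as u + v.\<close>
  define S where "S n = V' n \<inter> msum scale U {f. D f \<in> W' n}" for n
  have "\<exists>c. \<forall>n\<ge>c. S (Suc n) = smod scale I (S n)"
  proof (rule artin_rees_family[OF R I V])
    show sS: "subspace (S n)" for n
      unfolding S_def by (intro subspace_inter subspace_msum sV')
    show "S n \<subseteq> (smod scale I ^^ n) V" for n
      unfolding S_def V'_def by blast
    show "smod scale I (S n) \<subseteq> S (Suc n)" for n
    proof (intro smod_least sS)
      fix b v assume b: "b \<in> I" and "v \<in> S n"
      then obtain u d where "v \<in> V' n" "u \<in> U" "D d \<in> W' n" "v = u + d"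
        unfolding S_def using U subspace_preimage[OF D sW'] by (auto simp: mem_msum)
      moreover from this have "b *s u + b *s d \<in> msum scale U {f. D f \<in> W' (Suc n)}"
        using b U by (intro msum_memI) (auto simp: subspace_scale D.scale W'_scale)
      ultimately show "b *s v \<in> S (Suc n)"
        unfolding S_def using V'_scale[OF b, of v n] by (simp add: scale_right_distrib)
    qed
  qed
  then obtain c1 where c1: "\<forall>n\<ge>c1. S (Suc n) = smod scale I (S n)" by blast
  \<comment> \<open>The cocycles in \<open>U\<close>. Only their images under \<open>D\<close> are
    contained in I^n W, so Artin-Rees determines them just up to the kernel of \<open>D\<close>; the
    summand \<open>U \<inter> {f. D f = 0}\<close> originates here.\<close>
  define Y where "Y n = U \<inter> {f. D f \<in> W' n}" for n
  have sY: "subspace (Y n)" for n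
    unfolding Y_def by (intro subspace_inter U subspace_preimage D sW')
  have "\<exists>c. \<forall>n\<ge>c. D ` Y (Suc n) = smod scale I (D ` Y n)"
  proof (rule artin_rees_family[OF R I W])
    show "subspace (D ` Y n)" for n
      using D sY subspace_image by blast
    show "D ` Y n \<subseteq> (smod scale I ^^ n) W" for n
      unfolding Y_def W'_def by blast
    have "smod scale I (Y n) \<subseteq> Y (Suc n)" for n
      by (intro smod_least sY) (use U in \<open>auto simp: Y_def D.scale subspace_scale W'_scale\<close>)
    then show "smod scale I (D ` Y n) \<subseteq> D ` Y (Suc n)" for n
      unfolding image_smod[OF D, symmetric] by blast
  qed
  then obtain c2 where c2: "\<forall>n\<ge>c2. D ` Y (Suc n) = smod scale I (D ` Y n)" by blast
  define c where "c = max c1 c2"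
  have Sc: "S (n + c) = (smod scale I ^^ n) (S c)" for n
    by (rule artin_rees_family_funpow[OF c1]) (simp add: c_def)
  have Yc: "D ` Y (n + c) = D ` (smod scale I ^^ n) (Y c)" for n
    unfolding image_smod_funpow[OF D]
    by (rule artin_rees_family_funpow[OF c2]) (simp add: c_def)
  have YZ: "Y n \<subseteq> Z n" for n
    unfolding Y_def Z using msum_upper1 by blast
  have SZ: "S n \<subseteq> msum scale U (Z n)" for n
  proof
    fix v assume "v \<in> S n"
    then obtain u d where v: "v \<in> V' n" "u \<in> U" "D d \<in> W' n" "v = u + d"
      unfolding S_def using U subspace_preimage[OF D sW'] by (auto simp: mem_msum)
    then have "d = - u + v" by simp
    also have "\<dots> \<in> msum scale U (V' n)"
      using v U by (intro msum_memI subspace_neg)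
    finally have "d \<in> Z n" unfolding Z using v by blast
    then show "v \<in> msum scale U (Z n)" unfolding v(4) using v(2) by (intro msum_memI)
  qed
  have "Z (n + c) \<subseteq> msum scale (U \<inter> {f. D f = 0}) ((smod scale I ^^ n) (Z c))" for n
  proof
    fix f assume f: "f \<in> Z (n + c)"
    then obtain u v where uv: "u \<in> U" "v \<in> V' (n + c)" "f = u + v" "D f \<in> W' (n + c)"
      unfolding Z using U sV' by (auto simp: mem_msum)
    then have "v = - u + f" by simp
    also have "\<dots> \<in> msum scale U {f. D f \<in> W' (n + c)}"
      using uv U by (intro msum_memI subspace_neg) auto
    finally have "v \<in> S (n + c)" unfolding S_def using uv by blast
    also have "\<dots> \<subseteq> (smod scale I ^^ n) (msum scale U (Z c))"
      unfolding Sc by (intro smod_funpow_mono SZ)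
    also have "\<dots> = msum scale ((smod scale I ^^ n) U) ((smod scale I ^^ n) (Z c))"
      by (intro smod_funpow_msum U sZ)
    finally obtain u' z where z: "u' \<in> (smod scale I ^^ n) U" "z \<in> (smod scale I ^^ n) (Z c)" "v = u' + z"
      using mem_msum[OF subspace_smod_funpow[OF U] subspace_smod_funpow[OF sZ]] by blast
    have "u' \<in> U" using smod_funpow_antimono[OF U le0] z(1) by auto
    then have "f - z \<in> U" using uv z U by (simp add: subspace_add)
    moreover have "D z \<in> W' (n + c)" using z(2) Z_funpow unfolding Z by blast
    then have "D (f - z) \<in> W' (n + c)" using uv(4) sW' by (simp add: D.diff subspace_diff)
    ultimately have "f - z \<in> Y (n + c)"
      unfolding Y_def by simp
    then have "D (f - z) \<in> D ` (smod scale I ^^ n) (Y c)"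
      unfolding Yc[symmetric] by (rule imageI)
    then obtain y where y: "y \<in> (smod scale I ^^ n) (Y c)" "D (f - z) = D y" by blast
    have "y \<in> U"
      using smod_funpow_antimono[OF sY le0] y(1) unfolding Y_def by auto
    have "f - z - y \<in> U \<inter> {f. D f = 0}"
      using \<open>f - z \<in> U\<close> \<open>y \<in> U\<close> y(2) U by (auto simp: subspace_diff D.diff)
    moreover have "z + y \<in> (smod scale I ^^ n) (Z c)"
      using z(2) y(1) smod_funpow_mono[OF YZ] by (intro subspace_add subspace_smod_funpow sZ) auto
    ultimately have "(f - z - y) + (z + y) \<in> msum scale (U \<inter> {f. D f = 0}) ((smod scale I ^^ n) (Z c))"
      by (rule msum_memI)
    then show "f \<in> msum scale (U \<inter> {f. D f = 0}) ((smod scale I ^^ n) (Z c))" by simp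
  qed
  moreover have "msum scale (U \<inter> {f. D f = 0}) ((smod scale I ^^ n) (Z c)) \<subseteq> Z (n + c)" for n
  proof (intro msum_least sZ Z_funpow)
    show "U \<inter> {f. D f = 0} \<subseteq> Z (n + c)"
      unfolding Z using msum_upper1 subspace_0[OF sW'] by auto
  qed
  ultimately show ?thesis by blast
qed

text \<open>The indices 0, 1, 2 stand for three consecutive degrees of a complex. A single
  \<open>D\<close> is both the incoming and the outgoing differential, since Koszul cochains of all
  degrees lie in one module of functions.\<close>

lemma eventually_const_exactness:
  assumes R: "noetherian_ring TYPE('a)" and I: "ideal I" and D: "module_hom scale scale D"
    and "subspace U0" "subspace V0" "subspace W1" "subspace U1"
    and V1: "subspace V1" "noetherian_module scale V1"
    and W2: "subspace W2" "noetherian_module scale W2"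
  shows "eventually_const (\<lambda>n. \<forall>f\<in>msum scale U1 ((smod scale I ^^ n) V1).
    D f \<in> (smod scale I ^^ n) W2 \<longrightarrow>
    (\<exists>g\<in>msum scale U0 ((smod scale I ^^ n) V0). f - D g \<in> (smod scale I ^^ n) W1))"
proof -
  interpret D: module_hom scale scale D by fact
  define Z where "Z n = msum scale U1 ((smod scale I ^^ n) V1) \<inter> {f. D f \<in> (smod scale I ^^ n) W2}" for n
  obtain c where c: "\<And>n. Z (n + c) = msum scale (U1 \<inter> {f. D f = 0}) ((smod scale I ^^ n) (Z c))"
    using cocycles_eventually[OF R I D, of U1 V1 W2] assms unfolding Z_def by blast
  have sZ: "subspace (Z n)" for n
    unfolding Z_def using W2 by (intro subspace_inter subspace_msum subspace_preimage D subspace_smod_funpow)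
  define B where "B n = msum scale (D ` U0) ((smod scale I ^^ n) (msum scale (D ` V0) W1))" for n
  \<comment> \<open>The description of the cocycles starts at index \<open>c\<close>, so the
    coboundaries are also taken at \<open>n + c\<close>; the shift is removed afterwards.\<close>
  have "eventually_const (\<lambda>n. msum scale (U1 \<inter> {f. D f = 0}) ((smod scale I ^^ n) (Z c)) \<subseteq> B (n + c))"
    unfolding B_def
  proof (rule eventually_const_inclusion)
    show "subspace (U1 \<inter> {f. D f = 0})"
      using subspace_preimage[OF D subspace_single_0] assms by (intro subspace_inter) auto
  qed (use assms sZ subspace_image subspace_msum in auto)
  then have "eventually_const (\<lambda>n. Z n \<subseteq> B n)"
    unfolding c[symmetric] by (rule eventually_const_shift)
  moreover have B: "B n = msum scale (D ` msum scale U0 ((smod scale I ^^ n) V0)) ((smod scale I ^^ n) W1)" for n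
    unfolding B_def using assms subspace_image
    by (simp add: image_msum image_smod_funpow smod_funpow_msum subspace_smod_funpow msum_assoc)
  have "f \<in> B n \<longleftrightarrow> (\<exists>g\<in>msum scale U0 ((smod scale I ^^ n) V0). f - D g \<in> (smod scale I ^^ n) W1)" for f n
  proof -
    have "f \<in> B n \<longleftrightarrow> (\<exists>g\<in>msum scale U0 ((smod scale I ^^ n) V0). \<exists>w\<in>(smod scale I ^^ n) W1. f = D g + w)"
      unfolding B using assms subspace_image[OF D subspace_msum] by (simp add: mem_msum subspace_smod_funpow)
    then show ?thesis by (metis add_diff_cancel_left' diff_add_cancel add.commute)
  qed
  then have "Z n \<subseteq> B n \<longleftrightarrow> (\<forall>f\<in>msum scale U1 ((smod scale I ^^ n) V1).
    D f \<in> (smod scale I ^^ n) W2 \<longrightarrow>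
    (\<exists>g\<in>msum scale U0 ((smod scale I ^^ n) V0). f - D g \<in> (smod scale I ^^ n) W1))" for n
    unfolding Z_def by (auto simp: subset_iff)
  ultimately show ?thesis by simp
qed

end

section \<open>Prime avoidance and zero divisors\<close>

lemma ideal_add: "ideal A \<Longrightarrow> a \<in> A \<Longrightarrow> b \<in> A \<Longrightarrow> a + b \<in> A"
  and ideal_diff: "ideal A \<Longrightarrow> a \<in> A \<Longrightarrow> b \<in> A \<Longrightarrow> a - b \<in> A"
  and ideal_mult: "ideal A \<Longrightarrow> a \<in> A \<Longrightarrow> c * a \<in> A"
  and ideal_0: "ideal A \<Longrightarrow> 0 \<in> A"
  unfolding ideal_def
  using module.subspace_add[OF module_mult] module.subspace_diff[OF module_mult]
    module.subspace_scale[OF module_mult] module.subspace_0[OF module_mult] by blast+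

definition prime_ideal :: "'a::comm_ring_1 set \<Rightarrow> bool" where
  "prime_ideal P \<longleftrightarrow> ideal P \<and> 1 \<notin> P \<and> (\<forall>a b. a * b \<in> P \<longrightarrow> a \<in> P \<or> b \<in> P)"

text \<open>Choose in each \<open>Q\<close> an element outside \<open>P\<close>; by primality their
  product stays outside \<open>P\<close>.\<close>

lemma prime_ideal_finite_Inter:
  assumes "prime_ideal P" "finite \<Q>" "\<And>Q. Q \<in> \<Q> \<Longrightarrow> ideal Q \<and> \<not> Q \<subseteq> P"
  shows "\<exists>w. w \<notin> P \<and> w \<in> \<Inter>\<Q>"
  using assms(2,3)
proof (induction \<Q>)
  case empty
  then show ?case using assms(1) unfolding prime_ideal_def by auto
next
  case (insert Q \<Q>)
  then obtain w where w: "w \<notin> P" "w \<in> \<Inter>\<Q>" by auto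
  from insert.prems obtain q where q: "ideal Q" "q \<in> Q" "q \<notin> P" by blast
  have "w * q \<notin> P" using w q assms(1) unfolding prime_ideal_def by blast
  moreover have "w * q \<in> Q'" if "Q' \<in> \<Q>" for Q'
    using that w ideal_mult[of Q' w q] insert.prems by (auto simp: mult.commute)
  ultimately show ?case
    using ideal_mult[OF q(1,2), of w] by blast
qed

text \<open>If an element \<open>y\<close> avoiding the other primes falls into \<open>P\<close>, it
  is corrected by some \<open>w\<close> in \<open>J\<close> and in all the other primes but not in
  \<open>P\<close>. Incomparability of the primes is what provides \<open>w\<close>; maximal
  annihilators satisfy it automatically.\<close>

lemma prime_avoidance:
  assumes J: "ideal J" and "finite \<P>" "\<And>P. P \<in> \<P> \<Longrightarrow> prime_ideal P \<and> \<not> J \<subseteq> P"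
    and "\<And>P Q. P \<in> \<P> \<Longrightarrow> Q \<in> \<P> \<Longrightarrow> P \<subseteq> Q \<Longrightarrow> P = Q"
  shows "\<exists>y\<in>J. y \<notin> \<Union>\<P>"
  using assms(2-)
proof (induction \<P>)
  case empty
  then show ?case using ideal_0[OF J] by auto
next
  case (insert P \<P>)
  then obtain y where y: "y \<in> J" "y \<notin> \<Union>\<P>" by auto
  show ?case
  proof (cases "y \<in> P")
    case False
    with y show ?thesis by auto
  next
    case True
    have P: "prime_ideal P" using insert.prems by blast
    have "\<exists>w. w \<notin> P \<and> w \<in> \<Inter>(insert J \<P>)"
    proof (rule prime_ideal_finite_Inter[OF P])
      fix Q assume Q: "Q \<in> insert J \<P>"
      show "ideal Q \<and> \<not> Q \<subseteq> P"
      proof (cases "Q = J")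
        case True
        then show ?thesis using J insert.prems(1) by blast
      next
        case False
        with Q have "Q \<in> \<P>" by blast
        with insert.hyps have "Q \<noteq> P" by blast
        with \<open>Q \<in> \<P>\<close> show ?thesis
          using insert.prems(1)[of Q] insert.prems(2)[of Q P] unfolding prime_ideal_def by auto
      qed
    qed (use insert.hyps in simp)
    then obtain w where w: "w \<notin> P" "w \<in> J" "\<And>Q. Q \<in> \<P> \<Longrightarrow> w \<in> Q" by auto
    have "y + w \<notin> P"
      using ideal_diff[of P "y + w" y] True w(1) P unfolding prime_ideal_def by auto
    moreover have "y + w \<notin> Q" if "Q \<in> \<P>" for Q
      using ideal_diff[of Q "y + w" w] y(2) w(3)[OF that] that insert.prems(1)
      unfolding prime_ideal_def by auto
    ultimately show ?thesis using ideal_add[OF J y(1) w(2)] by auto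
  qed
qed

context module
begin

text \<open>The maximal annihilators of nonzero elements of \<open>N/L\<close> are finitely many prime ideals which
  together contain all zero divisors.\<close>

lemma zero_divisors_common_annihilator:
  assumes R: "noetherian_ring TYPE('a)" and J: "ideal J"
    and N: "subspace N" "noetherian_module scale N" and L: "subspace L"
    and zd: "\<And>y. y \<in> J \<Longrightarrow> \<exists>z\<in>N - L. y *s z \<in> L"
  shows "\<exists>z\<in>N - L. \<forall>y\<in>J. y *s z \<in> L"
proof (rule ccontr)
  assume neg: "\<not> (\<exists>z\<in>N - L. \<forall>y\<in>J. y *s z \<in> L)"
  define ann where "ann z = {c. c *s z \<in> L}" for z
  \<comment> \<open>The elements, nonzero modulo \<open>L\<close>, whose annihilator is maximal
    among all such annihilators.\<close>
  define Z where "Z = {z \<in> N - L. \<forall>z'\<in>N - L. ann z \<subseteq> ann z' \<longrightarrow> ann z' = ann z}"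
  interpret ring: module "(*) :: 'a \<Rightarrow> 'a \<Rightarrow> 'a" by (rule module_mult)
  have ann: "ideal (ann z)" for z
    unfolding ideal_def ann_def using L
    by (intro ring.subspaceI) (auto simp: subspace_0 subspace_add scale_left_distrib subspace_scale
      simp flip: scale_scale)
  have R': "noetherian_module (*) (UNIV :: 'a set)"
    using R unfolding noetherian_ring_def noetherian_module_def fin_gen_def ideal_def by blast
  have prime: "prime_ideal (ann z)" if z: "z \<in> Z" for z
    unfolding prime_ideal_def
  proof (intro conjI allI impI ann)
    show "1 \<notin> ann z" using z unfolding ann_def Z_def by simp
    fix a b assume ab: "a * b \<in> ann z"
    show "a \<in> ann z \<or> b \<in> ann z"
    proof (rule disjCI)
      assume "b \<notin> ann z"
      \<comment> \<open>The multiple \<open>b *s z\<close> is again nonzero modulo \<open>L\<close>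
        and has at least the annihilator of \<open>z\<close>, hence the same one by
        maximality.\<close>
      then have bz: "b *s z \<in> N - L"
        using z N(1) unfolding Z_def ann_def by (auto simp: subspace_scale)
      have "ann z \<subseteq> ann (b *s z)"
        unfolding ann_def using L subspace_scale by (auto simp: mult.commute simp flip: scale_scale)
          (metis mult.commute scale_scale)
      then have "ann (b *s z) = ann z" using z bz unfolding Z_def by blast
      then show "a \<in> ann z" using ab unfolding ann_def by auto
    qed
  qed
  have covered: "\<exists>z'\<in>Z. ann z \<subseteq> ann z'" if z: "z \<in> N - L" for z
  proof -
    obtain Y where Y: "Y \<in> ann ` {z' \<in> N - L. ann z \<subseteq> ann z'}"
      "\<And>Y'. Y' \<in> ann ` {z' \<in> N - L. ann z \<subseteq> ann z'} \<Longrightarrow> Y \<subseteq> Y' \<Longrightarrow> Y' = Y"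
      by (rule ring.noetherian_maximal[OF R', of "ann ` {z' \<in> N - L. ann z \<subseteq> ann z'}"])
        (use z ann in \<open>auto simp: ideal_def\<close>)
    then obtain z' where z': "z' \<in> N - L" "ann z \<subseteq> ann z'" "Y = ann z'" by blast
    have "z' \<in> Z"
      unfolding Z_def using z' Y(2) by blast
    then show ?thesis using z' by blast
  qed
  \<comment> \<open>A finite subset of \<open>Z\<close> with the largest possible span captures all
    of \<open>Z\<close>. Finiteness of the set of primes rests on this choice.\<close>
  obtain Y where Y: "Y \<in> {span F |F. finite F \<and> F \<subseteq> Z}"
      "\<And>Y'. Y' \<in> {span F |F. finite F \<and> F \<subseteq> Z} \<Longrightarrow> Y \<subseteq> Y' \<Longrightarrow> Y' = Y"
  proof (rule noetherian_maximal[OF N(2), of "{span F |F. finite F \<and> F \<subseteq> Z}"])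
    show "{span F |F. finite F \<and> F \<subseteq> Z} \<noteq> {}" by blast
    show "subspace Y \<and> Y \<subseteq> N" if "Y \<in> {span F |F. finite F \<and> F \<subseteq> Z}" for Y
      using that span_minimal[of _ N] N(1) unfolding Z_def by blast
  qed blast
  then obtain F where F: "finite F" "F \<subseteq> Z" "Y = span F" by blast
  have ZF: "Z \<subseteq> span F"
  proof
    fix z assume "z \<in> Z"
    then have "span (insert z F) = Y"
      using F by (intro Y(2)) (auto intro: span_mono[THEN subsetD])
    then show "z \<in> span F" using F(3) span_base by blast
  qed
  \<comment> \<open>A new prime would admit some \<open>w\<close> outside it that sends all of
    \<open>F\<close> into \<open>L\<close>, hence also \<open>span F\<close>, which contains
    \<open>z\<close>.\<close>
  have ann_F: "ann z \<in> ann ` F" if z: "z \<in> Z" for z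
  proof (rule ccontr)
    assume notin: "ann z \<notin> ann ` F"
    have "\<exists>w. w \<notin> ann z \<and> w \<in> \<Inter>(ann ` F)"
    proof (rule prime_ideal_finite_Inter[OF prime[OF z]])
      fix Q assume "Q \<in> ann ` F"
      then obtain x where x: "x \<in> F" "Q = ann x" by blast
      then have "ann x \<noteq> ann z" using notin by auto
      moreover have "z \<in> N - L" using z unfolding Z_def by blast
      moreover have "x \<in> Z" using x F(2) by blast
      ultimately have "\<not> ann x \<subseteq> ann z" unfolding Z_def by blast
      then show "ideal Q \<and> \<not> Q \<subseteq> ann z" using ann x(2) by blast
    qed (use F in simp)
    then obtain w where w: "w \<notin> ann z" "\<And>x. x \<in> F \<Longrightarrow> w *s x \<in> L"
      unfolding ann_def by auto
    have "span F \<subseteq> {x. w *s x \<in> L}"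
      using w(2) by (intro span_minimal subspace_preimage module_hom_scale_self L) auto
    then show False using w(1) z ZF unfolding ann_def by blast
  qed
  \<comment> \<open>By the negated claim \<open>J\<close> lies in none of these primes, so some
    \<open>y\<close> in \<open>J\<close> avoids them all; such a \<open>y\<close> cannot be a zero
    divisor.\<close>
  have "\<exists>y\<in>J. y \<notin> \<Union>(ann ` F)"
  proof (rule prime_avoidance[OF J])
    show "finite (ann ` F)" using F by simp
    show "prime_ideal P \<and> \<not> J \<subseteq> P" if P: "P \<in> ann ` F" for P
    proof -
      obtain z where z: "z \<in> Z" "P = ann z" using P F by blast
      moreover from z have "z \<in> N - L" unfolding Z_def by simp
      with neg have "\<not> J \<subseteq> ann z" unfolding ann_def by blast
      ultimately show ?thesis using prime by blast
    qed
    show "P = Q" if "P \<in> ann ` F" "Q \<in> ann ` F" "P \<subseteq> Q" for P Q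
      using that F unfolding Z_def by blast
  qed
  then obtain y where y: "y \<in> J" "y \<notin> \<Union>(ann ` F)" by blast
  obtain z where z: "z \<in> N - L" "y \<in> ann z" using zd[OF y(1)] unfolding ann_def by blast
  obtain z' where "z' \<in> Z" "ann z \<subseteq> ann z'" using covered[OF z(1)] by blast
  then show False using ann_F y(2) z(2) by blast
qed

end

section \<open>The Koszul complex\<close>

text \<open>The Koszul cochain complex of \<open>x\<^sub>1, \<dots>, x\<^sub>r\<close>. A cochain is a function of 0/1-words of length
  \<open>r\<close>, the words being the subsets of \<open>{1, \<dots>, r}\<close>; the recursion is the mapping cone of
  multiplication by the head of the list, so that no explicit signs occur.\<close>

fun koszul_d ::
  "('a::comm_ring_1 \<Rightarrow> 'b::ab_group_add \<Rightarrow> 'b) \<Rightarrow> 'a list \<Rightarrow> (bool list \<Rightarrow> 'b) \<Rightarrow> bool list \<Rightarrow> 'b" where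
  "koszul_d scale (x # xs) f (False # w) = koszul_d scale xs (\<lambda>v. f (False # v)) w"
| "koszul_d scale (x # xs) f (True # w) = scale x (f (False # w)) - koszul_d scale xs (\<lambda>v. f (True # v)) w"
| "koszul_d scale [] f w = 0"
| "koszul_d scale xs f [] = 0"

text \<open>Contraction with the linear form of coefficients \<open>cs\<close>; it lowers the degree
  by one. The sign in the \<open>True\<close> branch matches the one in
  \<open>koszul_d\<close>.\<close>

fun koszul_h ::
  "('a::comm_ring_1 \<Rightarrow> 'b::ab_group_add \<Rightarrow> 'b) \<Rightarrow> 'a list \<Rightarrow> (bool list \<Rightarrow> 'b) \<Rightarrow> bool list \<Rightarrow> 'b" where
  "koszul_h scale (c # cs) f (False # w) = scale c (f (True # w)) + koszul_h scale cs (\<lambda>v. f (False # v)) w"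
| "koszul_h scale (c # cs) f (True # w) = - koszul_h scale cs (\<lambda>v. f (True # v)) w"
| "koszul_h scale [] f w = 0"
| "koszul_h scale cs f [] = 0"

text \<open>Cochains of degree \<open>k - 1\<close>; the shift makes \<open>k = 0\<close> the zero module in degree \<open>-1\<close>.\<close>

definition cochains :: "nat \<Rightarrow> nat \<Rightarrow> 'b::zero set \<Rightarrow> (bool list \<Rightarrow> 'b) set" where
  "cochains r k N = {f. \<forall>w. f w \<in> (if length w = r \<and> Suc (count_list w True) = k then N else {0})}"

text \<open>Vanishing of the cohomology of N/L in degree \<open>k\<close>, with representatives in
  \<open>N\<close> and equations modulo \<open>L\<close>. By the index shift of
  \<open>cochains\<close>, degree \<open>k\<close> carries the index \<open>Suc k\<close>.\<close>

definition koszul_exact ::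
  "('a::comm_ring_1 \<Rightarrow> 'b::ab_group_add \<Rightarrow> 'b) \<Rightarrow> 'a list \<Rightarrow> 'b set \<Rightarrow> 'b set \<Rightarrow> nat \<Rightarrow> bool" where
  "koszul_exact scale xs N L k \<longleftrightarrow>
    (\<forall>f\<in>cochains (length xs) (Suc k) N. (\<forall>w. koszul_d scale xs f w \<in> L) \<longrightarrow>
      (\<exists>g\<in>cochains (length xs) k N. \<forall>w. f w - koszul_d scale xs g w \<in> L))"

lemma cochainsD:
  assumes "f \<in> cochains r k N"
  shows "length w = r \<Longrightarrow> Suc (count_list w True) = k \<Longrightarrow> f w \<in> N"
    and "\<not> (length w = r \<and> Suc (count_list w True) = k) \<Longrightarrow> f w = 0"
  using assms unfolding cochains_def by (auto split: if_splits dest!: spec[of _ w])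

lemma cochains_0: "f \<in> cochains r 0 N \<longleftrightarrow> f = (\<lambda>w. 0)"
  by (auto simp: cochains_def)

lemma cochains_False: "f \<in> cochains (Suc r) k N \<Longrightarrow> (\<lambda>w. f (False # w)) \<in> cochains r k N"
  using cochainsD[of f "Suc r" k N "False # _"] unfolding cochains_def[of r] by auto

lemma cochains_True: "f \<in> cochains (Suc r) (Suc k) N \<Longrightarrow> (\<lambda>w. f (True # w)) \<in> cochains r k N"
  using cochainsD[of f "Suc r" "Suc k" N "True # _"] unfolding cochains_def[of r] by auto

lemma cochains_Cons_iff:
  "f \<in> cochains (Suc r) (Suc k) N \<longleftrightarrow>
    f [] = 0 \<and> (\<lambda>w. f (False # w)) \<in> cochains r (Suc k) N \<and> (\<lambda>w. f (True # w)) \<in> cochains r k N"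
proof
  assume f: "f [] = 0 \<and> (\<lambda>w. f (False # w)) \<in> cochains r (Suc k) N \<and> (\<lambda>w. f (True # w)) \<in> cochains r k N"
  show "f \<in> cochains (Suc r) (Suc k) N"
    unfolding cochains_def
  proof (clarify)
    fix w
    show "f w \<in> (if length w = Suc r \<and> Suc (count_list w True) = Suc k then N else {0})"
    proof (cases w)
      case (Cons b v)
      then show ?thesis using f unfolding cochains_def by (cases b) simp_all
    qed (use f in simp)
  qed
qed (simp add: cochains_False cochains_True cochainsD(2))

lemma cochains_mem: "f \<in> cochains r k N \<Longrightarrow> 0 \<in> N \<Longrightarrow> f w \<in> N"
  using cochainsD[of f r k N w] by metis

lemma cochains_values: "f \<in> cochains r k N \<Longrightarrow> (\<And>w. f w \<in> L) \<Longrightarrow> f \<in> cochains r k L"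
  using cochainsD(2)[of f r k N] unfolding cochains_def[of r k L] by auto

text \<open>The choice is made word by word. The operation \<open>h\<close> is arbitrary because
  both \<open>a + b\<close> and \<open>a + y *s b\<close> occur; \<open>h 0 0 = 0\<close> takes care
  of the words outside the support.\<close>

lemma cochains_decompose:
  assumes "f \<in> cochains r k N" and "\<And>x. x \<in> N \<Longrightarrow> \<exists>a\<in>A. \<exists>b\<in>B. x = h a b" and "h 0 0 = 0"
  shows "\<exists>a\<in>cochains r k A. \<exists>b\<in>cochains r k B. f = (\<lambda>w. h (a w) (b w))"
proof -
  obtain p q where pq: "\<And>x. x \<in> N \<Longrightarrow> p x \<in> A \<and> q x \<in> B \<and> x = h (p x) (q x)"
    using assms(2) by metis
  let ?S = "\<lambda>w. length w = r \<and> Suc (count_list w True) = k"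
  let ?a = "\<lambda>w. if ?S w then p (f w) else 0" and ?b = "\<lambda>w. if ?S w then q (f w) else 0"
  have "?a \<in> cochains r k A" "?b \<in> cochains r k B"
    using cochainsD(1)[OF assms(1)] pq unfolding cochains_def by auto
  moreover have "f = (\<lambda>w. h (?a w) (?b w))"
  proof
    fix w show "f w = h (?a w) (?b w)"
      using cochainsD[OF assms(1), of w] pq[of "f w"] assms(3) by (cases "?S w") auto
  qed
  ultimately show ?thesis by (intro bexI[of _ ?a] bexI[of _ ?b])
qed

lemma bool_list_cases [case_names Nil False True]:
  assumes "w = [] \<Longrightarrow> P" "\<And>v. w = False # v \<Longrightarrow> P" "\<And>v. w = True # v \<Longrightarrow> P"
  shows P
  using assms by (metis (full_types) neq_Nil_conv)

section \<open>Linearity of differential and contraction, the homotopy, degrees\<close>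

context module
begin

lemma subspace_cochains_0: "subspace N \<Longrightarrow> (\<lambda>w. 0) \<in> cochains r k N"
  by (simp add: cochains_def subspace_0)

lemma cochains_add:
  "subspace N \<Longrightarrow> f \<in> cochains r k N \<Longrightarrow> g \<in> cochains r k N \<Longrightarrow> (\<lambda>w. f w + g w) \<in> cochains r k N"
  unfolding cochains_def by (auto simp: subspace_add split: if_splits)

lemma cochains_scale:
  "subspace N \<Longrightarrow> f \<in> cochains r k N \<Longrightarrow> (\<lambda>w. c *s f w) \<in> cochains r k N"
  unfolding cochains_def by (auto simp: subspace_scale split: if_splits)

lemma cochains_diff:
  "subspace N \<Longrightarrow> f \<in> cochains r k N \<Longrightarrow> g \<in> cochains r k N \<Longrightarrow> (\<lambda>w. f w - g w) \<in> cochains r k N"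
  unfolding cochains_def by (auto simp: subspace_diff split: if_splits)

lemma cochains_minus:
  "subspace N \<Longrightarrow> f \<in> cochains r k N \<Longrightarrow> (\<lambda>w. - f w) \<in> cochains r k N"
  unfolding cochains_def by (auto simp: subspace_neg split: if_splits)

lemma koszul_d_add: "koszul_d scale xs (\<lambda>v. f v + g v) w = koszul_d scale xs f w + koszul_d scale xs g w"
proof (induction xs arbitrary: f g w)
  case (Cons x xs)
  show ?case by (cases w rule: bool_list_cases) (simp_all add: Cons.IH scale_right_distrib)
qed simp

lemma koszul_d_scale: "koszul_d scale xs (\<lambda>v. c *s f v) w = c *s koszul_d scale xs f w"
proof (induction xs arbitrary: f w)
  case (Cons x xs)
  show ?case by (cases w rule: bool_list_cases) (simp_all add: Cons.IH scale_right_diff_distrib mult.commute)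
qed simp

lemma koszul_d_zero: "koszul_d scale xs (\<lambda>v. 0) w = 0"
  using koszul_d_scale[of xs 0 "\<lambda>v. 0" w] by simp

lemma koszul_d_diff: "koszul_d scale xs (\<lambda>v. f v - g v) w = koszul_d scale xs f w - koszul_d scale xs g w"
  using koszul_d_add[of xs f "\<lambda>v. (- 1) *s g v" w] koszul_d_scale[of xs "- 1" g w] by simp

lemma koszul_d_minus: "koszul_d scale xs (\<lambda>v. - f v) w = - koszul_d scale xs f w"
  using koszul_d_scale[of xs "- 1" f w] by simp

lemma koszul_h_add: "koszul_h scale xs (\<lambda>v. f v + g v) w = koszul_h scale xs f w + koszul_h scale xs g w"
proof (induction xs arbitrary: f g w)
  case (Cons x xs)
  show ?case by (cases w rule: bool_list_cases) (simp_all add: Cons.IH scale_right_distrib)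
qed simp

lemma koszul_h_scale: "koszul_h scale xs (\<lambda>v. c *s f v) w = c *s koszul_h scale xs f w"
proof (induction xs arbitrary: f w)
  case (Cons x xs)
  show ?case by (cases w rule: bool_list_cases) (simp_all add: Cons.IH scale_right_distrib mult.commute)
qed simp

lemma koszul_h_zero: "koszul_h scale xs (\<lambda>v. 0) w = 0"
  using koszul_h_scale[of xs 0 "\<lambda>v. 0" w] by simp

lemma koszul_h_diff: "koszul_h scale xs (\<lambda>v. f v - g v) w = koszul_h scale xs f w - koszul_h scale xs g w"
  using koszul_h_add[of xs f "\<lambda>v. (- 1) *s g v" w] koszul_h_scale[of xs "- 1" g w] by simp

text \<open>The minus sign in the \<open>True\<close> branch makes the two terms containing the head
  of the list cancel.\<close>

lemma koszul_d_d: "koszul_d scale xs (koszul_d scale xs f) w = 0"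
proof (induction xs arbitrary: f w)
  case (Cons x xs)
  show ?case by (cases w rule: bool_list_cases) (simp_all add: Cons.IH koszul_d_diff koszul_d_scale)
qed simp

text \<open>The homotopy behind the fact that the ideal generated by \<open>xs\<close> annihilates
  Koszul cohomology. In the induction the mixed terms cancel, and the heads contribute
  \<open>c * x\<close>.\<close>

lemma koszul_homotopy:
  "length cs = length xs \<Longrightarrow> length w = length xs \<Longrightarrow>
    koszul_d scale xs (koszul_h scale cs f) w + koszul_h scale cs (koszul_d scale xs f) w =
    (\<Sum>(c, x)\<leftarrow>zip cs xs. c * x) *s f w"
proof (induction xs arbitrary: cs f w)
  case (Cons x xs)
  obtain c ds where cs: "cs = c # ds" using Cons.prems by (cases cs) auto
  with Cons.prems have ds: "length ds = length xs" by simp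
  show ?case
  proof (cases w rule: bool_list_cases)
    case Nil
    then show ?thesis using Cons.prems by simp
  next
    case (False v)
    with Cons.IH[OF ds, of v "\<lambda>v. f (False # v)"] Cons.prems show ?thesis
      by (simp add: cs koszul_d_add koszul_d_scale algebra_simps)
  next
    case (True v)
    with Cons.IH[OF ds, of v "\<lambda>v. f (True # v)"] Cons.prems show ?thesis
      by (simp add: cs koszul_d_minus koszul_h_diff koszul_h_scale algebra_simps)
  qed
qed simp

lemma koszul_d_cochains:
  "subspace N \<Longrightarrow> f \<in> cochains (length xs) k N \<Longrightarrow> koszul_d scale xs f \<in> cochains (length xs) (Suc k) N"
proof (induction xs arbitrary: f k)
  case Nil
  then show ?case by (simp add: cochains_def subspace_0)
next
  case (Cons x xs)
  show ?case
  proof (cases k)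
    case 0
    with Cons.prems have "f = (\<lambda>w. 0)" by (simp add: cochains_0)
    then have "koszul_d scale (x # xs) f = (\<lambda>w. 0)" by (intro ext) (simp only: koszul_d_zero)
    then show ?thesis using Cons.prems by (simp add: subspace_cochains_0)
  next
    case (Suc j)
    with Cons.prems have "(\<lambda>w. f (False # w)) \<in> cochains (length xs) k N"
      "(\<lambda>w. f (True # w)) \<in> cochains (length xs) j N"
      by (simp_all add: cochains_False cochains_True)
    with Cons show ?thesis
      by (simp add: cochains_Cons_iff Suc cochains_diff cochains_scale)
  qed
qed

lemma koszul_h_cochains:
  "subspace N \<Longrightarrow> f \<in> cochains (length cs) (Suc k) N \<Longrightarrow> koszul_h scale cs f \<in> cochains (length cs) k N"
proof (induction cs arbitrary: f k)
  case Nil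
  then show ?case by (simp add: cochains_def subspace_0)
next
  case (Cons c cs)
  then have f: "(\<lambda>w. f (False # w)) \<in> cochains (length cs) (Suc k) N"
      "(\<lambda>w. f (True # w)) \<in> cochains (length cs) k N"
    by (simp_all add: cochains_False cochains_True)
  show ?case
  proof (cases k)
    case 0
    then have "(\<lambda>w. f (True # w)) = (\<lambda>w. 0)" using f(2) by (simp add: cochains_0)
    moreover have "koszul_h scale cs (\<lambda>w. f (False # w)) = (\<lambda>w. 0)"
      using Cons.IH[OF Cons.prems(1) f(1)] 0 by (simp add: cochains_0)
    ultimately have "koszul_h scale (c # cs) f w = 0" for w
      by (cases w rule: bool_list_cases) (simp_all add: fun_eq_iff koszul_h_zero)
    then show ?thesis by (simp add: 0 cochains_0 fun_eq_iff)
  next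
    case (Suc j)
    with f Cons show ?thesis
      by (simp add: cochains_Cons_iff cochains_add cochains_scale cochains_minus)
  qed
qed

end

lemma count_list_replicate: "count_list (replicate n x) x = n"
  by (induction n) simp_all

lemma span_set_list:
  assumes "y \<in> module.span (*) (set xs)"
  shows "\<exists>cs. length cs = length xs \<and> y = (\<Sum>(c, x)\<leftarrow>zip cs xs. c * x)"
  using assms
proof (induction xs arbitrary: y)
  case Nil
  then show ?case by (simp add: module.span_empty[OF module_mult])
next
  case (Cons a xs)
  then obtain k where "y - k * a \<in> module.span (*) (set xs)"
    by (auto simp: module.span_insert[OF module_mult])
  then obtain cs where "length cs = length xs" "y - k * a = (\<Sum>(c, x)\<leftarrow>zip cs xs. c * x)"
    using Cons.IH by blast
  then show ?case by (intro exI[of _ "k # cs"]) (simp add: algebra_simps)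
qed

section \<open>Vanishing in degree zero, in top degree and modulo a regular element\<close>

context module
begin

text \<open>A cochain of degree zero is an element z placed at the all-\<open>False\<close> word,
  and the nontrivial entries of its differential are the multiples of z by members of
  \<open>xs\<close>. Degree -1 is zero, so there are no coboundaries to divide out.\<close>

lemma koszul_exact_0:
  assumes N: "subspace N" and L: "subspace L"
  shows "koszul_exact scale xs N L 0 \<longleftrightarrow> (\<forall>z\<in>N. (\<forall>x\<in>set xs. x *s z \<in> L) \<longrightarrow> z \<in> L)"
proof -
  let ?o = "replicate (length xs) False"
  have o: "w = ?o \<longleftrightarrow> length w = length xs \<and> count_list w True = 0" for w
    by (auto simp: count_list_0_iff intro!: replicate_eqI)
  have supp: "f w = 0" if "f \<in> cochains (length xs) (Suc 0) N" "w \<noteq> ?o" for f w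
    using cochainsD(2)[OF that(1), of w] that(2) o by auto
  have down: "x *s f ?o \<in> L"
    if "f \<in> cochains (length xs) (Suc 0) N" "\<forall>w. koszul_d scale xs f w \<in> L" "x \<in> set xs" for f x
    using that
  proof (induction xs arbitrary: f)
    case (Cons a xs)
    then have f: "(\<lambda>w. f (False # w)) \<in> cochains (length xs) (Suc 0) N" "(\<lambda>w. f (True # w)) = (\<lambda>w. 0)"
      by (auto simp: cochains_Cons_iff cochains_0)
    have "koszul_d scale (a # xs) f (False # w) \<in> L" for w
      using Cons.prems(2) by blast
    then have "x *s f (False # replicate (length xs) False) \<in> L" if "x \<in> set xs"
      using Cons.IH[OF f(1) _ that] by simp
    moreover have "koszul_d scale (a # xs) f (True # replicate (length xs) False) \<in> L"
      using Cons.prems(2) by blast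
    then have "a *s f (False # replicate (length xs) False) \<in> L"
      by (simp add: f(2) koszul_d_zero)
    ultimately show ?case using Cons.prems(3) by auto
  qed simp
  have up: "koszul_d scale xs (\<lambda>w. if w = ?o then z else 0) w \<in> L"
    if "\<forall>x\<in>set xs. x *s z \<in> L" for z w
    using that
  proof (induction xs arbitrary: w)
    case Nil
    then show ?case using L by (simp add: subspace_0)
  next
    case (Cons a xs)
    then show ?case using L
      by (cases w rule: bool_list_cases) (auto simp: subspace_0 koszul_d_zero)
  qed
  have single: "(\<lambda>w. if w = ?o then z else 0) \<in> cochains (length xs) (Suc 0) N" if "z \<in> N" for z
    unfolding cochains_def using that o by auto
  show ?thesis
  proof
    assume E: "koszul_exact scale xs N L 0"
    show "\<forall>z\<in>N. (\<forall>x\<in>set xs. x *s z \<in> L) \<longrightarrow> z \<in> L"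
    proof (intro ballI impI)
      fix z assume z: "z \<in> N" "\<forall>x\<in>set xs. x *s z \<in> L"
      let ?f = "\<lambda>w. if w = ?o then z else 0"
      obtain g where "g \<in> cochains (length xs) 0 N" "\<forall>w. ?f w - koszul_d scale xs g w \<in> L"
        using E[unfolded koszul_exact_def] single[OF z(1)] up[OF z(2)] by blast
      then have "?f ?o - koszul_d scale xs (\<lambda>w. 0) ?o \<in> L"
        unfolding cochains_0 by blast
      then show "z \<in> L" by (simp add: koszul_d_zero)
    qed
  next
    assume A: "\<forall>z\<in>N. (\<forall>x\<in>set xs. x *s z \<in> L) \<longrightarrow> z \<in> L"
    show "koszul_exact scale xs N L 0"
      unfolding koszul_exact_def
    proof (intro ballI impI)
      fix f assume f: "f \<in> cochains (length xs) (Suc 0) N" "\<forall>w. koszul_d scale xs f w \<in> L"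
      have "f ?o \<in> L"
        using A down[OF f] cochains_mem[OF f(1)] N subspace_0 by blast
      then have "f w \<in> L" for w
        using supp[OF f(1), of w] L by (cases "w = ?o") (auto simp: subspace_0)
      then show "\<exists>g\<in>cochains (length xs) 0 N. \<forall>w. f w - koszul_d scale xs g w \<in> L"
        by (simp add: cochains_0 koszul_d_zero)
    qed
  qed
qed

lemma koszul_d_smod:
  assumes "\<And>w. f w \<in> N"
  shows "koszul_d scale xs f w \<in> smod scale (set xs) N"
  using assms
proof (induction xs arbitrary: f w)
  case Nil
  then show ?case by (simp add: subspace_0 subspace_smod)
next
  case (Cons x xs)
  have IH: "koszul_d scale xs g v \<in> smod scale (set (x # xs)) N" if "\<And>w. g w \<in> N" for g v
    using Cons.IH[of g v] that smod_mono[of "set xs" "set (x # xs)" N N] by auto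
  have "x *s f v \<in> smod scale (set (x # xs)) N" for v
    using Cons.prems by (intro smodI) auto
  then show ?case
    using IH Cons.prems by (cases w rule: bool_list_cases)
      (auto simp: subspace_0 subspace_smod intro!: subspace_diff)
qed

text \<open>In top degree every cochain is a cocycle, while coboundaries take values in the product
  of \<open>set xs\<close> with \<open>N\<close>.\<close>

lemma koszul_exact_top:
  assumes N: "subspace N" and L: "subspace L" and E: "koszul_exact scale xs N L (length xs)"
  shows "N \<subseteq> msum scale L (smod scale (set xs) N)"
proof
  fix z assume z: "z \<in> N"
  let ?t = "replicate (length xs) True"
  let ?f = "\<lambda>w. if w = ?t then z else 0"
  have f: "?f \<in> cochains (length xs) (Suc (length xs)) N"
    unfolding cochains_def using z N count_list_replicate[of "length xs" True]
    by (auto simp: subspace_0)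
  \<comment> \<open>A nonzero value would need a word with more entries \<open>True\<close> than its
    length.\<close>
  have "koszul_d scale xs ?f w = 0" for w
    using cochainsD(2)[OF koszul_d_cochains[OF N f], of w] count_le_length[of w True] by auto
  then have "\<forall>w. koszul_d scale xs ?f w \<in> L"
    using subspace_0[OF L] by simp
  then obtain g where g: "g \<in> cochains (length xs) (length xs) N" "\<forall>w. ?f w - koszul_d scale xs g w \<in> L"
    using E f unfolding koszul_exact_def by blast
  have "koszul_d scale xs g ?t \<in> smod scale (set xs) N"
    using cochains_mem[OF g(1) subspace_0[OF N]] by (rule koszul_d_smod)
  moreover have "z - koszul_d scale xs g ?t \<in> L" using g(2)[rule_format, of ?t] by simp
  ultimately have "(z - koszul_d scale xs g ?t) + koszul_d scale xs g ?t \<in> msum scale L (smod scale (set xs) N)"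
    by (intro msum_memI)
  then show "z \<in> msum scale L (smod scale (set xs) N)" by simp
qed

text \<open>Multiplication by \<open>y\<close> on N/L is injective and induces zero on cohomology,
  so the long exact sequence splits into short ones 0 -> H^i(N/L) -> H^i(N/L') -> H^(i+1)(N/L) -> 0.
  The facts \<open>down\<close> and \<open>up\<close> are the corresponding diagram chases.\<close>

lemma koszul_exact_regular:
  assumes N: "subspace N" and L: "subspace L" "L \<subseteq> N"
    and y: "y \<in> module.span (*) (set xs)" and reg: "\<And>z. z \<in> N \<Longrightarrow> y *s z \<in> L \<Longrightarrow> z \<in> L"
  defines "L' \<equiv> msum scale L ((*s) y ` N)"
  shows "(\<forall>i<t. koszul_exact scale xs N L' i) \<longleftrightarrow> (\<forall>i<Suc t. koszul_exact scale xs N L i)"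
proof -
  let ?d = "koszul_d scale xs" and ?C = "cochains (length xs)"
  have yN: "subspace ((*s) y ` N)" using N by (rule subspace_image[OF module_hom_scale_self])
  have L': "x \<in> L' \<longleftrightarrow> (\<exists>l\<in>L. \<exists>n\<in>N. x = l + y *s n)" for x
    unfolding L'_def using L(1) yN by (auto simp: mem_msum)
  have sL': "subspace L'" unfolding L'_def by (rule subspace_msum)
  have LL': "L \<subseteq> L'" unfolding L'_def by (rule msum_upper1)
  have N0: "0 \<in> N" and L0: "0 \<in> L" using N L subspace_0 by auto
  have split: "\<exists>a\<in>?C k L. \<exists>b\<in>?C k N. f = (\<lambda>w. a w + y *s b w)" if "f \<in> ?C k L'" for f k
    using cochains_decompose[OF that, of L N "\<lambda>a b. a + y *s b"] L' by auto
  have down: "koszul_exact scale xs N L' i"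
    if E: "koszul_exact scale xs N L i" "koszul_exact scale xs N L (Suc i)" for i
    unfolding koszul_exact_def
  proof (intro ballI impI)
    fix f assume f: "f \<in> ?C (Suc i) N" "\<forall>w. ?d f w \<in> L'"
    have "?d f \<in> ?C (Suc (Suc i)) L'"
      by (rule cochains_values[OF koszul_d_cochains[OF N f(1)]]) (use f(2) in blast)
    \<comment> \<open>The connecting map sends \<open>f\<close> to \<open>g\<close>; regularity of
      \<open>y\<close> makes \<open>g\<close> a cocycle modulo \<open>L\<close>.\<close>
    then obtain l g where lg: "l \<in> ?C (Suc (Suc i)) L" "g \<in> ?C (Suc (Suc i)) N" "?d f = (\<lambda>w. l w + y *s g w)"
      using split by blast
    have "?d g w \<in> L" for w
    proof (rule reg)
      show "?d g w \<in> N" using cochains_mem[OF koszul_d_cochains[OF N lg(2)] N0] .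
      have "?d l w + y *s ?d g w = 0"
        using koszul_d_d[of xs f w] unfolding lg(3) by (simp add: koszul_d_add koszul_d_scale)
      then have "y *s ?d g w = - ?d l w" by (simp add: eq_neg_iff_add_eq_0 add.commute)
      also have "\<dots> \<in> L" using cochains_mem[OF koszul_d_cochains[OF L(1) lg(1)] L0] L(1) subspace_neg by blast
      finally show "y *s ?d g w \<in> L" .
    qed
    then obtain h where h: "h \<in> ?C (Suc i) N" "\<And>w. g w - ?d h w \<in> L"
      using E(2) lg(2) unfolding koszul_exact_def by blast
    have fh: "(\<lambda>w. f w - y *s h w) \<in> ?C (Suc i) N"
      using f(1) h(1) N by (intro cochains_diff cochains_scale)
    have "?d (\<lambda>w. f w - y *s h w) w \<in> L" for w
    proof -
      have "?d (\<lambda>w. f w - y *s h w) w = l w + y *s (g w - ?d h w)"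
        unfolding koszul_d_diff koszul_d_scale lg(3) by (simp add: algebra_simps)
      also have "\<dots> \<in> L"
        using h(2) L(1) cochains_mem[OF lg(1) L0] by (intro subspace_add subspace_scale)
      finally show ?thesis .
    qed
    then obtain k where k: "k \<in> ?C i N" "\<And>w. f w - y *s h w - ?d k w \<in> L"
      using E(1) fh unfolding koszul_exact_def by blast
    have "f w - ?d k w \<in> L'" for w
      unfolding L' using k(2)[of w] cochains_mem[OF h(1) N0, of w]
      by (intro bexI[of _ "f w - y *s h w - ?d k w"] bexI[of _ "h w"]) auto
    then show "\<exists>g\<in>?C i N. \<forall>w. f w - ?d g w \<in> L'" using k(1) by blast
  qed
  have up: "koszul_exact scale xs N L (Suc i)" if E: "koszul_exact scale xs N L' i" for i
    unfolding koszul_exact_def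
  proof (intro ballI impI)
    fix g assume g: "g \<in> ?C (Suc (Suc i)) N" "\<forall>w. ?d g w \<in> L"
    obtain cs where cs: "length cs = length xs" "y = (\<Sum>(c, x)\<leftarrow>zip cs xs. c * x)"
      using span_set_list[OF y] by blast
    \<comment> \<open>Since \<open>y\<close> is the combination of \<open>xs\<close> with
      coefficients \<open>cs\<close>, the homotopy gives d f = y g - h(d g). Thus \<open>f\<close>
      is a cocycle modulo \<open>L'\<close> which the connecting map sends to the class of
      \<open>g\<close>.\<close>
    define f where "f = koszul_h scale cs g"
    have f: "f \<in> ?C (Suc i) N"
      unfolding f_def using koszul_h_cochains[OF N, of g cs] g(1) cs(1) by simp
    have dg: "?d g \<in> ?C (Suc (Suc (Suc i))) L"
      by (rule cochains_values[OF koszul_d_cochains[OF N g(1)]]) (use g(2) in blast)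
    have hdg: "koszul_h scale cs (?d g) w \<in> L" for w
      using koszul_h_cochains[OF L(1), of "?d g" cs] dg cs(1) cochains_mem[OF _ L0] by metis
    have hom: "?d f w + koszul_h scale cs (?d g) w = y *s g w" for w
    proof (cases "length w = length xs")
      case True
      then show ?thesis unfolding f_def cs(2) by (intro koszul_homotopy cs)
    next
      case False
      then have "?d f w = 0" "g w = 0"
        using cochainsD(2)[OF koszul_d_cochains[OF N f]] cochainsD(2)[OF g(1)] by auto
      moreover have "koszul_h scale cs (?d g) w = 0"
        using koszul_h_cochains[OF L(1), of "?d g" cs] dg cs(1) cochainsD(2) False by metis
      ultimately show ?thesis by simp
    qed
    have "?d f w \<in> L'" for w
    proof -
      have "?d f w = - koszul_h scale cs (?d g) w + y *s g w"
        using hom[of w] by (simp add: algebra_simps)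
      then show ?thesis unfolding L'
        using hdg L(1) subspace_neg cochains_mem[OF g(1) N0] by blast
    qed
    then obtain k where k: "k \<in> ?C i N" "\<And>w. f w - ?d k w \<in> L'"
      using E f unfolding koszul_exact_def by blast
    have "(\<lambda>w. f w - ?d k w) \<in> ?C (Suc i) N"
      using koszul_d_cochains[OF N k(1)] f N by (intro cochains_diff)
    then have "(\<lambda>w. f w - ?d k w) \<in> ?C (Suc i) L'"
      by (rule cochains_values) (rule k(2))
    then obtain l m where lm: "l \<in> ?C (Suc i) L" "m \<in> ?C (Suc i) N"
      "(\<lambda>w. f w - ?d k w) = (\<lambda>w. l w + y *s m w)"
      using split by blast
    \<comment> \<open>Applying the differential to f - d k = l + y m removes k; comparison with the
      homotopy puts y (g - d m) into \<open>L\<close>, and regularity cancels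
      \<open>y\<close>.\<close>
    have "g w - ?d m w \<in> L" for w
    proof (rule reg)
      show "g w - ?d m w \<in> N"
        using cochains_mem[OF g(1) N0] cochains_mem[OF koszul_d_cochains[OF N lm(2)] N0] N subspace_diff by blast
      have "?d f w = ?d l w + y *s ?d m w"
        using arg_cong[OF lm(3), of "\<lambda>h. ?d h w"]
        by (simp add: koszul_d_diff koszul_d_add koszul_d_scale koszul_d_d)
      then have "y *s (g w - ?d m w) = ?d l w + koszul_h scale cs (?d g) w"
        using hom[of w] by (simp add: algebra_simps)
      also have "\<dots> \<in> L"
        using hdg cochains_mem[OF koszul_d_cochains[OF L(1) lm(1)] L0] L(1) subspace_add by blast
      finally show "y *s (g w - ?d m w) \<in> L" .
    qed
    then show "\<exists>h\<in>?C (Suc i) N. \<forall>w. g w - ?d h w \<in> L" using lm(2) by blast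
  qed
  \<comment> \<open>\<open>up\<close> reaches only positive degrees. In degree zero, an element
    multiplied into \<open>L\<close> by all of \<open>xs\<close> is also multiplied into
    \<open>L\<close> by \<open>y\<close>, which lies in the ideal they generate.\<close>
  have zero: "koszul_exact scale xs N L 0"
    unfolding koszul_exact_0[OF N L(1)]
  proof (intro ballI impI)
    fix z assume z: "z \<in> N" "\<forall>x\<in>set xs. x *s z \<in> L"
    have "y *s z \<in> smod scale (module.span (*) (set xs)) (span {z})"
      using y by (intro smodI span_base) auto
    also have "\<dots> = smod scale (set xs) (span {z})"
      by (intro smod_generators) simp
    also have "\<dots> \<subseteq> L"
    proof (intro smod_least L)
      fix a x assume "a \<in> set xs" "x \<in> span {z}"
      then show "a *s x \<in> L" using z L(1) by (auto simp: span_singleton) (metis mult.commute scale_scale subspace_scale)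
    qed
    finally show "z \<in> L" using reg z by blast
  qed
  show ?thesis
    using down up zero by (metis Suc_less_eq less_Suc_eq_0_disj less_SucI not0_implies_Suc)
qed

end

section \<open>Depth\<close>

abbreviation (input) fun_scale :: "('a \<Rightarrow> 'b \<Rightarrow> 'b) \<Rightarrow> 'a \<Rightarrow> ('c \<Rightarrow> 'b) \<Rightarrow> 'c \<Rightarrow> 'b" where
  "fun_scale scale \<equiv> \<lambda>c f w. scale c (f w)"

context module
begin

lemma smod_empty: "smod scale {} N = {0}"
  by (simp add: smod_def)

lemma msum_commute: "msum scale A B = msum scale B A"
  by (simp add: msum_def Un_commute)

lemma msum_0: "subspace L \<Longrightarrow> msum scale L {0} = L"
  using msum_least[of L L "{0}"] msum_upper1[of L "{0}"] by (auto simp: subspace_0)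

lemma msum_smod_insert:
  assumes N: "subspace N" and L: "subspace L"
  shows "msum scale L (smod scale (insert y A) N) =
    msum scale (msum scale L (smod scale A N)) ((*s) y ` N)"
proof (intro equalityI msum_least subspace_msum)
  let ?R = "msum scale (msum scale L (smod scale A N)) ((*s) y ` N)"
  let ?Q = "msum scale L (smod scale (insert y A) N)"
  have 1: "L \<subseteq> msum scale L (smod scale A N)" "smod scale A N \<subseteq> msum scale L (smod scale A N)"
    by (rule msum_upper1 msum_upper2)+
  have 2: "msum scale L (smod scale A N) \<subseteq> ?R" "(*s) y ` N \<subseteq> ?R"
    by (rule msum_upper1 msum_upper2)+
  show "L \<subseteq> ?R" using 1 2 by blast
  show "smod scale (insert y A) N \<subseteq> ?R"
  proof (intro smod_least subspace_msum)
    fix a x assume "a \<in> insert y A" "x \<in> N"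
    then show "a *s x \<in> ?R" using 1(2) 2 smodI[of a A x N] by auto
  qed
  have 3: "smod scale (insert y A) N \<subseteq> ?Q" by (rule msum_upper2)
  show "L \<subseteq> ?Q" by (rule msum_upper1)
  show "smod scale A N \<subseteq> ?Q"
    using smod_mono[of A "insert y A" N N] 3 by blast
  show "(*s) y ` N \<subseteq> ?Q"
    using 3 smodI[of y "insert y A" _ N] by blast
qed

lemma regular_seq_snoc:
  "regular_seq scale J N L (xs @ [y]) \<longleftrightarrow>
    regular_seq scale J N L xs \<and> y \<in> J \<and>
    (\<forall>z\<in>N. y *s z \<in> msum scale L (smod scale (set xs) N) \<longrightarrow> z \<in> msum scale L (smod scale (set xs) N)) \<and>
    \<not> N \<subseteq> msum scale L (smod scale (insert y (set xs)) N)"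
proof -
  have "msum scale L (smod scale (set xs) N) \<subseteq> msum scale L (smod scale (insert y (set xs)) N)"
    by (intro msum_mono smod_mono) auto
  then show ?thesis
    unfolding regular_seq_def by (simp add: less_Suc_eq nth_append all_conj_distrib imp_conjR ball_conj_distrib) blast
qed

text \<open>Each further element of the regular sequence lowers the first degree of nonvanishing by
  one. Induction runs from the right end because a new element is regular on the quotient by the
  earlier ones.\<close>

lemma koszul_exact_regular_seq:
  assumes N: "subspace N" and L: "subspace L" "L \<subseteq> N" and J: "J = module.span (*) (set gs)"
    and reg: "regular_seq scale J N L xs"
  shows "(\<forall>i<t. koszul_exact scale gs N (msum scale L (smod scale (set xs) N)) i) \<longleftrightarrow>
    (\<forall>i<t + length xs. koszul_exact scale gs N L i)"
  using reg
proof (induction xs arbitrary: t rule: rev_induct)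
  case Nil
  then show ?case using L by (simp add: smod_empty msum_0)
next
  case (snoc y xs)
  let ?L = "msum scale L (smod scale (set xs) N)"
  from snoc.prems have xs: "regular_seq scale J N L xs"
    and y: "y \<in> J" "\<And>z. z \<in> N \<Longrightarrow> y *s z \<in> ?L \<Longrightarrow> z \<in> ?L"
    unfolding regular_seq_snoc by blast+
  have LN: "?L \<subseteq> N" by (intro msum_least N L smod_subset)
  have "(\<forall>i<t. koszul_exact scale gs N (msum scale ?L ((*s) y ` N)) i) \<longleftrightarrow>
      (\<forall>i<Suc t. koszul_exact scale gs N ?L i)"
    using y J by (intro koszul_exact_regular N LN subspace_msum) auto
  also have "\<dots> \<longleftrightarrow> (\<forall>i<Suc t + length xs. koszul_exact scale gs N L i)"
    by (rule snoc.IH[OF xs])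
  finally show ?case
    using msum_smod_insert[OF N L(1), of y "set xs"] by simp
qed

text \<open>A regular sequence cannot be longer than the first degree of nonvanishing. If it is
  maximal, \<open>J\<close> consists of zero divisors on the remaining quotient, hence annihilates a
  nonzero element there, and cohomology in degree zero forces equality.\<close>

lemma depth_koszul:
  assumes R: "noetherian_ring TYPE('a)" and J: "J = module.span (*) (set gs)"
    and N: "subspace N" "noetherian_module scale N" and L: "subspace L" "L \<subseteq> N"
    and proper: "\<not> N \<subseteq> msum scale L (smod scale J N)"
  shows "\<not> koszul_exact scale gs N L (length gs)"
    and "depth scale J N L = enat (LEAST k. \<not> koszul_exact scale gs N L k)"
proof -
  let ?E = "koszul_exact scale gs N L"
  define D where "D = (LEAST k. \<not> ?E k)"
  have idJ: "ideal J"
    unfolding ideal_def J by (rule module.subspace_span[OF module_mult])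
  have gsJ: "set gs \<subseteq> J"
    unfolding J by (rule module.span_superset[OF module_mult])
  show top: "\<not> ?E (length gs)"
    using koszul_exact_top[OF N(1) L(1)] proper smod_generators[OF N(1), of "set gs"] J by metis
  then have ED: "\<not> ?E D" unfolding D_def by (rule LeastI)
  have proper': "\<not> N \<subseteq> msum scale L (smod scale A N)" if "A \<subseteq> J" for A
    using proper msum_mono[OF order_refl smod_mono[OF that order_refl]] by blast
  \<comment> \<open>For \<open>t = 0\<close> the left-hand side of the equivalence is vacuous, so
    all degrees below \<open>length xs\<close> vanish.\<close>
  have le: "length xs \<le> D" if "regular_seq scale J N L xs" for xs
    using koszul_exact_regular_seq[OF N(1) L J that, of 0] ED by (metis less_nat_zero_code add_0 not_le)
  have maximal: "length xs = D" if "maximal_regular_seq scale J N L xs" for xs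
  proof -
    let ?L = "msum scale L (smod scale (set xs) N)"
    from that have xs: "regular_seq scale J N L xs" "\<And>y. y \<in> J \<Longrightarrow> \<not> regular_seq scale J N L (xs @ [y])"
      unfolding maximal_regular_seq_def by blast+
    have "\<exists>z\<in>N - ?L. y *s z \<in> ?L" if y: "y \<in> J" for y
    proof -
      have "insert y (set xs) \<subseteq> J" using xs(1) y unfolding regular_seq_def by blast
      then show ?thesis
        using xs(2)[OF y] xs(1) y proper' unfolding regular_seq_snoc by blast
    qed
    then obtain z where "z \<in> N - ?L" "\<forall>y\<in>J. y *s z \<in> ?L"
      using zero_divisors_common_annihilator[OF R idJ N subspace_msum] by blast
    then have "\<not> koszul_exact scale gs N ?L 0"
      unfolding koszul_exact_0[OF N(1) subspace_msum] using gsJ by blast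
    then obtain i where "i < Suc (length xs)" "\<not> ?E i"
      using koszul_exact_regular_seq[OF N(1) L J xs(1), of 1] by auto
    then have "D \<le> length xs" unfolding D_def using Least_le[of "\<lambda>k. \<not> ?E k" i] by simp
    with le[OF xs(1)] show ?thesis by simp
  qed
  have "regular_seq scale J N L []"
    using proper'[of "{}"] unfolding regular_seq_def by simp
  \<comment> \<open>A regular sequence of greatest length exists by the bound and is maximal.
    Without it the supremum would be over the empty set and give 0.\<close>
  then obtain xs where xs: "regular_seq scale J N L xs"
    "\<And>ys. regular_seq scale J N L ys \<Longrightarrow> length ys \<le> length xs"
    using ex_has_greatest_nat[of "regular_seq scale J N L" "[]" length "Suc D"] le
    by (metis le_imp_less_Suc)
  then have "maximal_regular_seq scale J N L xs"
    unfolding maximal_regular_seq_def using xs(2)[of "xs @ [_]"] by auto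
  then have "{enat (length xs) |xs. maximal_regular_seq scale J N L xs} = {enat D}"
    using maximal by auto
  then show "depth scale J N L = enat (LEAST k. \<not> ?E k)"
    unfolding depth_def D_def using proper by simp
qed

lemma smod_commute: "smod scale A (smod scale B X) = smod scale B (smod scale A X)"
proof -
  have "smod scale A (smod scale B X) \<subseteq> smod scale B (smod scale A X)" for A B
  proof (intro smod_least subspace_smod)
    fix a y assume a: "a \<in> A" and y: "y \<in> smod scale B X"
    have "smod scale B X \<subseteq> {x. a *s x \<in> smod scale B (smod scale A X)}"
    proof (intro smod_least subspace_preimage module_hom_scale_self subspace_smod)
      fix b x assume "b \<in> B" "x \<in> X"
      then have "b *s (a *s x) \<in> smod scale B (smod scale A X)" using a by (intro smodI)
      then show "b *s x \<in> {x. a *s x \<in> smod scale B (smod scale A X)}" by (simp add: mult.commute)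
    qed
    with y show "a *s y \<in> smod scale B (smod scale A X)" by blast
  qed
  then show ?thesis by blast
qed

lemma smod_funpow_commute: "smod scale A ((smod scale B ^^ n) X) = (smod scale B ^^ n) (smod scale A X)"
  by (induction n) (simp_all add: smod_commute[of A])

section \<open>Cochains as submodules of a function module\<close>

lemma module_fun_scale: "module (fun_scale scale)"
  by standard (auto simp: fun_eq_iff algebra_simps)

lemma module_hom_single: "module_hom scale (fun_scale scale) (\<lambda>z v. if v = w then z else 0)"
proof -
  interpret F: module "fun_scale scale" by (rule module_fun_scale)
  show ?thesis by unfold_locales (auto simp: fun_eq_iff)
qed

lemma module_hom_koszul_d: "module_hom (fun_scale scale) (fun_scale scale) (koszul_d scale xs)"
proof -
  interpret F: module "fun_scale scale" by (rule module_fun_scale)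
  show ?thesis
    by unfold_locales (auto simp: fun_eq_iff koszul_d_scale plus_fun_def koszul_d_add)
qed

lemma subspace_cochains:
  assumes "subspace N"
  shows "module.subspace (fun_scale scale) (cochains r k N)"
  using assms cochains_add[OF assms] cochains_scale[OF assms] subspace_cochains_0[OF assms]
  by (intro module.subspaceI[OF module_fun_scale]) (auto simp: zero_fun_def plus_fun_def)

text \<open>There are finitely many words of length \<open>r\<close>, so every cochain is a finite
  sum of cochains supported on one word. Statements about products and generators thereby reduce to
  the coefficient module.\<close>

lemma cochains_least:
  assumes S: "module.subspace (fun_scale scale) S"
    and single: "\<And>w z. length w = r \<Longrightarrow> Suc (count_list w True) = k \<Longrightarrow> z \<in> N \<Longrightarrow> (\<lambda>v. if v = w then z else 0) \<in> S"
  shows "cochains r k N \<subseteq> S"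
proof
  fix f assume f: "f \<in> cochains r k N"
  interpret F: module "fun_scale scale" by (rule module_fun_scale)
  have fin: "finite {w :: bool list. length w = r}"
    using finite_lists_length_eq[of "UNIV :: bool set" r] by simp
  have sum_apply: "(\<Sum>w\<in>A. h w) v = (\<Sum>w\<in>A. h w v)" if "finite A" for h :: "bool list \<Rightarrow> bool list \<Rightarrow> 'b" and A v
    using that by (induction A) auto
  have "f = (\<Sum>w\<in>{w. length w = r}. (\<lambda>v. if v = w then f w else 0))"
  proof
    fix v
    show "f v = (\<Sum>w\<in>{w. length w = r}. (\<lambda>v. if v = w then f w else 0)) v"
      using cochainsD(2)[OF f, of v] by (auto simp: sum_apply[OF fin] fin)
  qed
  also have "\<dots> \<in> S"
  proof (rule F.subspace_sum[OF S])
    fix w :: "bool list" assume w: "w \<in> {w. length w = r}"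
    show "(\<lambda>v. if v = w then f w else 0) \<in> S"
    proof (cases "Suc (count_list w True) = k")
      case True
      then show ?thesis using w cochainsD(1)[OF f, of w] by (intro single) auto
    next
      case False
      then have "(\<lambda>v. if v = w then f w else 0) = 0" using cochainsD(2)[OF f, of w] by auto
      then show ?thesis using F.subspace_0[OF S] by simp
    qed
  qed
  finally show "f \<in> S" .
qed

lemma cochains_msum:
  assumes "subspace A" "subspace B"
  shows "cochains r k (msum scale A B) = msum (fun_scale scale) (cochains r k A) (cochains r k B)"
proof -
  interpret F: module "fun_scale scale" by (rule module_fun_scale)
  have "\<exists>a\<in>cochains r k A. \<exists>b\<in>cochains r k B. f = (\<lambda>w. a w + b w)" if "f \<in> cochains r k (msum scale A B)" for f
    using mem_msum[OF assms] by (intro cochains_decompose[OF that]) auto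
  moreover have "(\<lambda>w. a w + b w) \<in> cochains r k (msum scale A B)"
    if "a \<in> cochains r k A" "b \<in> cochains r k B" for a b
    by (intro cochains_add subspace_msum cochains_values[OF that(1)] cochains_values[OF that(2)]
        subsetD[OF msum_upper1] subsetD[OF msum_upper2] cochains_mem[OF that(1)] cochains_mem[OF that(2)]
        subspace_0 assms)
  ultimately show ?thesis
    using F.mem_msum[OF subspace_cochains subspace_cochains, OF assms] by (auto simp: plus_fun_def)
qed

lemma cochains_smod:
  assumes N: "subspace N"
  shows "cochains r k (smod scale A N) = smod (fun_scale scale) A (cochains r k N)"
proof -
  interpret F: module "fun_scale scale" by (rule module_fun_scale)
  show ?thesis
  proof (intro equalityI cochains_least F.subspace_smod F.smod_least subspace_cochains subspace_smod)
    fix a f assume a: "a \<in> A" and f: "f \<in> cochains r k N"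
    show "fun_scale scale a f \<in> cochains r k (smod scale A N)"
      by (rule cochains_values[OF cochains_scale[OF N f]])
        (intro smodI a cochains_mem[OF f subspace_0[OF N]])
  next
    fix w :: "bool list" and z
    assume w: "length w = r" "Suc (count_list w True) = k" and z: "z \<in> smod scale A N"
    let ?s = "\<lambda>z v. if v = w then z else 0"
    interpret s: module_hom scale "fun_scale scale" ?s by (rule module_hom_single)
    have "smod scale A N \<subseteq> ?s -` smod (fun_scale scale) A (cochains r k N)"
    proof (intro smod_least s.subspace_vimage F.subspace_smod)
      fix a x assume "a \<in> A" "x \<in> N"
      then have "(fun_scale scale) a (?s x) \<in> smod (fun_scale scale) A (cochains r k N)"
        using w by (intro F.smodI) (auto simp: cochains_def subspace_0[OF N])
      then show "a *s x \<in> ?s -` smod (fun_scale scale) A (cochains r k N)"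
        by (simp add: s.scale)
    qed
    with z show "?s z \<in> smod (fun_scale scale) A (cochains r k N)" by blast
  qed
qed

lemma cochains_smod_funpow:
  assumes N: "subspace N"
  shows "cochains r k ((smod scale A ^^ n) N) = (smod (fun_scale scale) A ^^ n) (cochains r k N)"
  by (induction n) (simp_all add: cochains_smod subspace_smod_funpow N)

lemma noetherian_cochains:
  assumes R: "noetherian_ring TYPE('a)" and T: "fin_gen scale T"
  shows "noetherian_module (fun_scale scale) (cochains r k T)"
proof -
  interpret F: module "fun_scale scale" by (rule module_fun_scale)
  obtain G where G: "finite G" "T = span G" using T unfolding fin_gen_def by blast
  define H where "H = (\<lambda>(w, z) v. if v = w then z else 0) ` ({w :: bool list. length w = r} \<times> G)"
  have "finite H"
    unfolding H_def using G(1) finite_lists_length_eq[of "UNIV :: bool set" r] by simp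
  then have "noetherian_module (fun_scale scale) (F.span H)"
    by (rule F.noetherian_span_finite[OF R])
  moreover have "cochains r k T \<subseteq> F.span H"
  proof (intro cochains_least F.subspace_span)
    fix w :: "bool list" and z assume w: "length w = r" and z: "z \<in> T"
    let ?s = "\<lambda>z v. if v = w then z else 0"
    interpret s: module_hom scale "fun_scale scale" ?s by (rule module_hom_single)
    have "span G \<subseteq> ?s -` F.span H"
      by (intro span_minimal s.subspace_vimage F.subspace_span)
        (use w in \<open>auto simp: H_def intro!: F.span_base\<close>)
    with z G show "?s z \<in> F.span H" by blast
  qed
  ultimately show ?thesis by (rule F.noetherian_subset)
qed

text \<open>Because cochains commute with sums and with I^n, vanishing in degree \<open>k\<close> is
  the abstract exactness statement for \<open>koszul_d\<close> on the function module, with cochain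
  indices \<open>k\<close>, \<open>Suc k\<close> and \<open>Suc (Suc k)\<close>.\<close>

lemma eventually_const_koszul_exact:
  assumes R: "noetherian_ring TYPE('a)" and I: "ideal I" and T: "fin_gen scale T"
    and U: "subspace U" and V: "subspace V" "V \<subseteq> T" and W: "subspace W" "W \<subseteq> V"
  shows "eventually_const (\<lambda>n. koszul_exact scale gs
    (msum scale U ((smod scale I ^^ n) V)) ((smod scale I ^^ n) W) k)"
proof -
  interpret F: module "fun_scale scale" by (rule module_fun_scale)
  let ?r = "length gs" and ?d = "koszul_d scale gs"
  have noeth: "noetherian_module (fun_scale scale) (cochains ?r j X)" if "X \<subseteq> T" "0 \<in> X" for j X
  proof (rule F.noetherian_subset[OF noetherian_cochains[OF R T]])
    show "cochains ?r j X \<subseteq> cochains ?r j T"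
    proof
      fix f assume f: "f \<in> cochains ?r j X"
      show "f \<in> cochains ?r j T"
        by (rule cochains_values[OF f]) (use cochains_mem[OF f that(2)] that(1) in blast)
    qed
  qed
  have "eventually_const (\<lambda>n. \<forall>f\<in>msum (fun_scale scale) (cochains ?r (Suc k) U) ((smod (fun_scale scale) I ^^ n) (cochains ?r (Suc k) V)).
    ?d f \<in> (smod (fun_scale scale) I ^^ n) (cochains ?r (Suc (Suc k)) W) \<longrightarrow>
    (\<exists>g\<in>msum (fun_scale scale) (cochains ?r k U) ((smod (fun_scale scale) I ^^ n) (cochains ?r k V)).
      f - ?d g \<in> (smod (fun_scale scale) I ^^ n) (cochains ?r (Suc k) W)))"
    using U V W by (intro F.eventually_const_exactness R I module_hom_koszul_d subspace_cochains noeth)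
      (auto simp: subspace_0)
  moreover have "koszul_exact scale gs (msum scale U ((smod scale I ^^ n) V)) ((smod scale I ^^ n) W) k \<longleftrightarrow>
    (\<forall>f\<in>msum (fun_scale scale) (cochains ?r (Suc k) U) ((smod (fun_scale scale) I ^^ n) (cochains ?r (Suc k) V)).
    ?d f \<in> (smod (fun_scale scale) I ^^ n) (cochains ?r (Suc (Suc k)) W) \<longrightarrow>
    (\<exists>g\<in>msum (fun_scale scale) (cochains ?r k U) ((smod (fun_scale scale) I ^^ n) (cochains ?r k V)).
      f - ?d g \<in> (smod (fun_scale scale) I ^^ n) (cochains ?r (Suc k) W)))" for n
  proof -
    let ?N = "msum scale U ((smod scale I ^^ n) V)" and ?L = "(smod scale I ^^ n) W"
    have N: "msum (fun_scale scale) (cochains ?r j U) ((smod (fun_scale scale) I ^^ n) (cochains ?r j V)) = cochains ?r j ?N" for j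
      using U V by (simp add: cochains_msum cochains_smod_funpow subspace_smod_funpow)
    have L: "(smod (fun_scale scale) I ^^ n) (cochains ?r j W) = cochains ?r j ?L" for j
      using W by (simp add: cochains_smod_funpow)
    have L0: "0 \<in> ?L" using W subspace_0 subspace_smod_funpow by blast
    \<comment> \<open>The support is already correct, so membership is a condition on values only;
      this matches the pointwise conditions in \<open>koszul_exact\<close>.\<close>
    have mem: "f \<in> cochains ?r j ?L \<longleftrightarrow> (\<forall>w. f w \<in> ?L)" if "f \<in> cochains ?r j ?N" for f j
    proof
      show "\<forall>w. f w \<in> ?L" if "f \<in> cochains ?r j ?L" using cochains_mem[OF that L0] by blast
      show "f \<in> cochains ?r j ?L" if "\<forall>w. f w \<in> ?L"
        by (rule cochains_values[OF \<open>f \<in> cochains ?r j ?N\<close>]) (use that in blast)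
    qed
    have d: "?d f \<in> cochains ?r (Suc j) ?N" if "f \<in> cochains ?r j ?N" for f j
      using that by (rule koszul_d_cochains[OF subspace_msum])
    have diff: "f - ?d g \<in> cochains ?r (Suc j) ?N"
      if "f \<in> cochains ?r (Suc j) ?N" "g \<in> cochains ?r j ?N" for f g j
      using F.subspace_diff[OF subspace_cochains[OF subspace_msum] that(1) d[OF that(2)]] .
    show ?thesis
      unfolding N L koszul_exact_def using mem d diff by simp
  qed
  ultimately show ?thesis by simp
qed

end

theorem theorem2p7:
  fixes scale :: "'a::comm_ring_1 \<Rightarrow> 'b::ab_group_add \<Rightarrow> 'b"
    and I J :: "'a set" and T U V W :: "'b set"
  assumes "module scale"
    and "noetherian_ring TYPE('a)"
    and "ideal I" and "ideal J"
    and "module.subspace scale T" and "fin_gen scale T"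
    and "module.subspace scale U" and "module.subspace scale V" and "module.subspace scale W"
    and "U \<subseteq> T" and "V \<subseteq> T" and "W \<subseteq> V"
  shows "\<exists>m. \<forall>n \<ge> m.
    depth scale J (msum scale U (smod scale (ideal_pow I n) V)) (smod scale (ideal_pow I n) W)
  = depth scale J (msum scale U (smod scale (ideal_pow I m) V)) (smod scale (ideal_pow I m) W)"
proof -
  interpret module scale by fact
  note R = assms(2) and sU = assms(7) and sV = assms(8) and sW = assms(9)
  define N where "N n = msum scale U ((smod scale I ^^ n) V)" for n
  define L where "L n = (smod scale I ^^ n) W" for n
  define P where "P n \<longleftrightarrow> N n \<subseteq> msum scale (L n) (smod scale J (N n))" for n
  obtain A where "finite A" "J = module.span (*) A"
    using R assms(4) unfolding noetherian_ring_def by blast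
  then obtain gs where gs: "J = module.span (*) (set gs)"
    using finite_list by metis
  define E where "E k n \<longleftrightarrow> koszul_exact scale gs (N n) (L n) k" for k n
  have sN: "subspace (N n)" and sL: "subspace (L n)" for n
    unfolding N_def L_def using sW subspace_msum subspace_smod_funpow by auto
  have LN: "L n \<subseteq> N n" for n
    unfolding N_def L_def using smod_funpow_mono[OF assms(12)] msum_upper2 by blast
  have "N n \<subseteq> T" for n
    unfolding N_def using smod_funpow_antimono[OF sV le0, of n I] assms(10,11) by (intro msum_least assms(5)) auto
  moreover have "noetherian_module scale T"
    using assms(6) noetherian_span_finite[OF R] unfolding fin_gen_def by blast
  ultimately have noeth: "noetherian_module scale (N n)" for n
    using noetherian_subset by blast
  \<comment> \<open>Moving \<open>J\<close> past I^n turns I^n W + J(U + I^n V) into JU + I^n(JV +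
    W), so the condition for infinite depth is another instance of the inclusion lemma, with shift
    0.\<close>
  have "P n \<longleftrightarrow> msum scale U ((smod scale I ^^ n) V) \<subseteq>
      msum scale (smod scale J U) ((smod scale I ^^ (n + 0)) (msum scale (smod scale J V) W))" for n
    unfolding P_def N_def L_def msum_commute[of "(smod scale I ^^ n) W"] using sU sV sW
    by (simp add: smod_msum smod_funpow_commute smod_funpow_msum subspace_smod subspace_smod_funpow
        msum_assoc)
  then have "eventually_const P"
    using eventually_const_inclusion[OF sU sV subspace_smod subspace_msum] by presburger
  moreover have "eventually_const (\<lambda>n k. k \<le> length gs \<and> E k n)"
    unfolding E_def N_def L_def
    by (intro eventually_const_bounded_family eventually_const_koszul_exact[OF R assms(3,6) sU sV assms(11) sW assms(12)])
  ultimately have "eventually_const (\<lambda>n. if P n then \<infinity> else enat (LEAST k. \<not> (k \<le> length gs \<and> E k n)))"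
    by (rule eventually_const_comp)
  moreover have "depth scale J (N n) (L n) =
      (if P n then \<infinity> else enat (LEAST k. \<not> (k \<le> length gs \<and> E k n)))" for n
  proof (cases "P n")
    case True
    then show ?thesis unfolding P_def depth_def by simp
  next
    case False
    note D = depth_koszul[OF R gs sN noeth sL LN False[unfolded P_def], folded E_def]
    \<comment> \<open>Cohomology in degree \<open>length gs\<close> is nonzero, so the first
      nonvanishing degree is within the truncation.\<close>
    have "(LEAST k. \<not> (k \<le> length gs \<and> E k n)) = (LEAST k. \<not> E k n)"
    proof (rule Least_equality)
      show "\<not> ((LEAST k. \<not> E k n) \<le> length gs \<and> E (LEAST k. \<not> E k n) n)"
        using LeastI[of "\<lambda>k. \<not> E k n", OF D(1)] by blast
      show "(LEAST k. \<not> E k n) \<le> k" if "\<not> (k \<le> length gs \<and> E k n)" for k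
        using that Least_le[of "\<lambda>k. \<not> E k n" k] Least_le[of "\<lambda>k. \<not> E k n", OF D(1)] by auto
    qed
    then show ?thesis using D(2) False by simp
  qed
  ultimately have "eventually_const (\<lambda>n. depth scale J (N n) (L n))"
    by simp
  then show ?thesis
    unfolding eventually_const_def eventually_sequentially N_def L_def
      smod_ideal_pow[OF sV] smod_ideal_pow[OF sW] by (metis order_refl)
qed

end
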